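(* Let $R$ be a unital ring and let $M$ be a left $R$-module. Suppose that all direct sum decompositions of $M$ refine into finite indecomposable direct sum decompositions (e.g. $M$ is Krull-Schmidt artinian). Then the following conditions are equivalent: 1. $M$ satisfies the $AKS_1$ condition. 2. $M$ satisfies the $AKS_2$ condition.
   Context: A direct sum decomposition of $M$ is an internal decomposition $M=\bigoplus_{\alpha\in A}M_\alpha$ with all $M_\alpha$ nonzero; it is indecomposable if every $M_\alpha$ is indecomposable, and finite if $A$ is finite. $M=\bigoplus_{\alpha\in A}M_\alpha$ refines into $M=\bigoplus_{\beta\in B}N_\beta$ if for each $\alpha\in A$ there is a direct sum decomposition $M_\alpha=\bigoplus_{\gamma_\alpha\in C_\alpha}M_{\gamma_\alpha}$ such that the decompositions $M=\bigoplus_{\alpha\in A}\bigl(\bigoplus_{\gamma_\alpha\in C_\alpha}M_{\gamma_\alpha}\bigr)$ and $M=\bigoplus_{\beta\in B}N_\beta$ are equal. Two decompositions $M=\bigoplus_{\alpha\in A}M_\alpha$ and $M=\bigoplus_{\beta\in B}N_\beta$ are decomposition-isomorphic if there is a bijection $\phi:A\to B$ such that $M_\alpha\cong N_{\phi(\alpha)}$ for every $\alpha\in A$. $M$ is Krull-Schmidt artinian if its set of direct summands, ordered by inclusion, satisfies the descending chain condition. $M$ satisfies $AKS_1$ if it admits only finitely many direct sum decompositions up to decomposition-isomorphisms; $M$ satisfies $AKS_2$ if it has only finitely many indecomposable direct sum decompositions up to decomposition-isomorphisms. *)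

theory Defs
  imports "HOL-Algebra.Module" "HOL-Algebra.AbelCoset"
begin

text \<open>The library's locale \<open>module\<close> requires a commutative ring of scalars; the following has the
  same axioms over an arbitrary (unital, associative) \<open>ring\<close>.\<close>

locale left_module = R?: ring R + M?: abelian_group M
  for R :: "('a, 'm) ring_scheme" (structure)
    and M :: "('a, 'b, 'n) module_scheme" (structure) +
  assumes smult_closed [simp, intro]:
      "\<lbrakk> a \<in> carrier R; x \<in> carrier M \<rbrakk> \<Longrightarrow> a \<odot>\<^bsub>M\<^esub> x \<in> carrier M"
    and smult_l_distr:
      "\<lbrakk> a \<in> carrier R; b \<in> carrier R; x \<in> carrier M \<rbrakk> \<Longrightarrow>
       (a \<oplus>\<^bsub>R\<^esub> b) \<odot>\<^bsub>M\<^esub> x = a \<odot>\<^bsub>M\<^esub> x \<oplus>\<^bsub>M\<^esub> b \<odot>\<^bsub>M\<^esub> x"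
    and smult_r_distr:
      "\<lbrakk> a \<in> carrier R; x \<in> carrier M; y \<in> carrier M \<rbrakk> \<Longrightarrow>
       a \<odot>\<^bsub>M\<^esub> (x \<oplus>\<^bsub>M\<^esub> y) = a \<odot>\<^bsub>M\<^esub> x \<oplus>\<^bsub>M\<^esub> a \<odot>\<^bsub>M\<^esub> y"
    and smult_assoc1:
      "\<lbrakk> a \<in> carrier R; b \<in> carrier R; x \<in> carrier M \<rbrakk> \<Longrightarrow>
       (a \<otimes>\<^bsub>R\<^esub> b) \<odot>\<^bsub>M\<^esub> x = a \<odot>\<^bsub>M\<^esub> (b \<odot>\<^bsub>M\<^esub> x)"
    and smult_one [simp]:
      "x \<in> carrier M \<Longrightarrow> \<one>\<^bsub>R\<^esub> \<odot>\<^bsub>M\<^esub> x = x"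

definition module_isomorphic ::
  "('a, 'm) ring_scheme \<Rightarrow> ('a, 'b, 'n) module_scheme \<Rightarrow> ('a, 'c, 'p) module_scheme \<Rightarrow> bool" where
  "module_isomorphic R M N \<longleftrightarrow>
     (\<exists>h \<in> iso (add_monoid M) (add_monoid N).
        \<forall>a \<in> carrier R. \<forall>x \<in> carrier M. h (a \<odot>\<^bsub>M\<^esub> x) = a \<odot>\<^bsub>N\<^esub> h x)"

text \<open>A submodule \<open>N\<close> of \<open>M\<close>, given as a subset of the carrier, regarded as a module.\<close>

abbreviation submodule_structure ::
  "('a, 'b, 'n) module_scheme \<Rightarrow> 'b set \<Rightarrow> ('a, 'b, 'n) module_scheme" where
  "submodule_structure M N \<equiv> M\<lparr>carrier := N\<rparr>"

text \<open>\<open>M\<close> is the internal direct sum of the family \<open>N\<close> of submodules indexed by \<open>A\<close>: every element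
  has a unique expression as a sum of members of the \<open>N i\<close>, almost all of them zero.\<close>

definition internal_direct_sum ::
  "('a, 'm) ring_scheme \<Rightarrow> ('a, 'b, 'n) module_scheme \<Rightarrow> 'i set \<Rightarrow> ('i \<Rightarrow> 'b set) \<Rightarrow> bool" where
  "internal_direct_sum R M A N \<longleftrightarrow>
     (\<forall>i \<in> A. submodule (N i) R M) \<and>
     (\<forall>x \<in> carrier M. \<exists>!f. f \<in> (\<Pi>\<^sub>E i \<in> A. N i) \<and> finite {i \<in> A. f i \<noteq> \<zero>\<^bsub>M\<^esub>} \<and>
        x = (\<Oplus>\<^bsub>M\<^esub> i \<in> {i \<in> A. f i \<noteq> \<zero>\<^bsub>M\<^esub>}. f i))"

text \<open>The members of an indexed decomposition are nonzero, hence pairwise distinct (see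
  \<open>indexed_decomposition_iff\<close> below), so up to renaming the indices a decomposition is the set of
  its summands, indexed by itself. In particular two decompositions are equal iff these sets are.\<close>

definition decomposition ::
  "('a, 'm) ring_scheme \<Rightarrow> ('a, 'b, 'n) module_scheme \<Rightarrow> 'b set set \<Rightarrow> bool" where
  "decomposition R M D \<longleftrightarrow>
     internal_direct_sum R M D (\<lambda>N. N) \<and> (\<forall>N \<in> D. N \<noteq> {\<zero>\<^bsub>M\<^esub>})"

definition complementary_submodules ::
  "('a, 'm) ring_scheme \<Rightarrow> ('a, 'b, 'n) module_scheme \<Rightarrow> 'b set \<Rightarrow> 'b set \<Rightarrow> bool" where
  "complementary_submodules R M K L \<longleftrightarrow>
     submodule K R M \<and> submodule L R M \<and> K \<inter> L = {\<zero>\<^bsub>M\<^esub>} \<and> K <+>\<^bsub>M\<^esub> L = carrier M"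

definition indecomposable_module ::
  "('a, 'm) ring_scheme \<Rightarrow> ('a, 'b, 'n) module_scheme \<Rightarrow> bool" where
  "indecomposable_module R M \<longleftrightarrow>
     carrier M \<noteq> {\<zero>\<^bsub>M\<^esub>} \<and>
     (\<forall>K L. complementary_submodules R M K L \<longrightarrow> K = {\<zero>\<^bsub>M\<^esub>} \<or> L = {\<zero>\<^bsub>M\<^esub>})"

definition indecomposable_decomposition ::
  "('a, 'm) ring_scheme \<Rightarrow> ('a, 'b, 'n) module_scheme \<Rightarrow> 'b set set \<Rightarrow> bool" where
  "indecomposable_decomposition R M D \<longleftrightarrow>
     decomposition R M D \<and> (\<forall>N \<in> D. indecomposable_module R (submodule_structure M N))"

definition refines_into ::
  "('a, 'm) ring_scheme \<Rightarrow> ('a, 'b, 'n) module_scheme \<Rightarrow> 'b set set \<Rightarrow> 'b set set \<Rightarrow> bool" where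
  "refines_into R M D E \<longleftrightarrow>
     (\<exists>C. (\<forall>N \<in> D. decomposition R (submodule_structure M N) (C N)) \<and> (\<Union>N \<in> D. C N) = E)"

definition decomposition_isomorphic ::
  "('a, 'm) ring_scheme \<Rightarrow> ('a, 'b, 'n) module_scheme \<Rightarrow> 'b set set \<Rightarrow> 'b set set \<Rightarrow> bool" where
  "decomposition_isomorphic R M D E \<longleftrightarrow>
     (\<exists>\<phi>. bij_betw \<phi> D E \<and>
        (\<forall>N \<in> D. module_isomorphic R (submodule_structure M N) (submodule_structure M (\<phi> N))))"

definition direct_summand ::
  "('a, 'm) ring_scheme \<Rightarrow> ('a, 'b, 'n) module_scheme \<Rightarrow> 'b set \<Rightarrow> bool" where
  "direct_summand R M N \<longleftrightarrow> (\<exists>K. complementary_submodules R M N K)"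

definition Krull_Schmidt_artinian ::
  "('a, 'm) ring_scheme \<Rightarrow> ('a, 'b, 'n) module_scheme \<Rightarrow> bool" where
  "Krull_Schmidt_artinian R M \<longleftrightarrow>
     (\<forall>N :: nat \<Rightarrow> 'b set. (\<forall>k. direct_summand R M (N k) \<and> N (Suc k) \<subseteq> N k) \<longrightarrow>
        (\<exists>k. \<forall>l \<ge> k. N l = N k))"

definition finitely_many_up_to :: "('x \<Rightarrow> 'x \<Rightarrow> bool) \<Rightarrow> 'x set \<Rightarrow> bool" where
  "finitely_many_up_to r S \<longleftrightarrow> finite (S // {(x, y). x \<in> S \<and> y \<in> S \<and> r x y})"

definition AKS1 :: "('a, 'm) ring_scheme \<Rightarrow> ('a, 'b, 'n) module_scheme \<Rightarrow> bool" where
  "AKS1 R M \<longleftrightarrow> finitely_many_up_to (decomposition_isomorphic R M) {D. decomposition R M D}"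

definition AKS2 :: "('a, 'm) ring_scheme \<Rightarrow> ('a, 'b, 'n) module_scheme \<Rightarrow> bool" where
  "AKS2 R M \<longleftrightarrow>
     finitely_many_up_to (decomposition_isomorphic R M) {D. indecomposable_decomposition R M D}"

definition all_refine_finite_indecomposable ::
  "('a, 'm) ring_scheme \<Rightarrow> ('a, 'b, 'n) module_scheme \<Rightarrow> bool" where
  "all_refine_finite_indecomposable R M \<longleftrightarrow>
     (\<forall>D. decomposition R M D \<longrightarrow>
        (\<exists>E. finite E \<and> indecomposable_decomposition R M E \<and> refines_into R M D E))"

lemma (in left_module) finsum_reindex_support:
  assumes inj: "inj_on N A" and f: "f \<in> (\<Pi>\<^sub>E K \<in> N ` A. K)"
    and sub: "\<And>i. i \<in> A \<Longrightarrow> N i \<subseteq> carrier M"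
  shows "(\<Oplus>\<^bsub>M\<^esub> i \<in> {i \<in> A. f (N i) \<noteq> \<zero>\<^bsub>M\<^esub>}. f (N i)) = (\<Oplus>\<^bsub>M\<^esub> K \<in> {K \<in> N ` A. f K \<noteq> \<zero>\<^bsub>M\<^esub>}. f K)"
    and "finite {i \<in> A. f (N i) \<noteq> \<zero>\<^bsub>M\<^esub>} \<longleftrightarrow> finite {K \<in> N ` A. f K \<noteq> \<zero>\<^bsub>M\<^esub>}"
proof -
  let ?S = "{i \<in> A. f (N i) \<noteq> \<zero>\<^bsub>M\<^esub>}"
  have im: "{K \<in> N ` A. f K \<noteq> \<zero>\<^bsub>M\<^esub>} = N ` ?S" by auto
  have inj': "inj_on N ?S" using inj by (auto intro: inj_on_subset)
  have "f \<in> N ` ?S \<rightarrow> carrier M" using f sub by (fastforce simp: PiE_def Pi_def)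
  from M.add.finprod_reindex[OF this inj']
  show "(\<Oplus>\<^bsub>M\<^esub> i \<in> ?S. f (N i)) = (\<Oplus>\<^bsub>M\<^esub> K \<in> {K \<in> N ` A. f K \<noteq> \<zero>\<^bsub>M\<^esub>}. f K)"
    unfolding im finsum_def by simp
  show "finite ?S \<longleftrightarrow> finite {K \<in> N ` A. f K \<noteq> \<zero>\<^bsub>M\<^esub>}"
    unfolding im using inj' by (simp add: finite_image_iff)
qed

lemma Ex1_unique: "\<exists>!x. P x \<Longrightarrow> P a \<Longrightarrow> P b \<Longrightarrow> a = b"
  by blast

lemma Ex1_transfer:
  assumes "\<And>f. f \<in> X \<Longrightarrow> P (F f) \<longleftrightarrow> Q f" and "\<And>f. Q f \<Longrightarrow> f \<in> X"
    and "\<And>g. P g \<Longrightarrow> G g \<in> X" and "\<And>g. P g \<Longrightarrow> F (G g) = g" and "\<And>f. f \<in> X \<Longrightarrow> G (F f) = f"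
  shows "(\<exists>!g. P g) \<longleftrightarrow> (\<exists>!f. Q f)"
proof
  assume "\<exists>!g. P g"
  then obtain g where "P g" "\<And>h. P h \<Longrightarrow> h = g" by auto
  then show "\<exists>!f. Q f" using assms by (intro ex1I[of _ "G g"]) metis+
next
  assume "\<exists>!f. Q f"
  then obtain f where "Q f" "\<And>h. Q h \<Longrightarrow> h = f" by auto
  then show "\<exists>!g. P g" using assms by (intro ex1I[of _ "F f"]) metis+
qed

lemma (in left_module) indexed_decomposition_inj:
  assumes ds: "internal_direct_sum R M A N" and nz: "\<And>i. i \<in> A \<Longrightarrow> N i \<noteq> {\<zero>\<^bsub>M\<^esub>}"
  shows "inj_on N A"
proof (rule inj_onI, rule ccontr)
  fix i j assume ij: "i \<in> A" "j \<in> A" "N i = N j" "i \<noteq> j"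
  have sm: "submodule (N k) R M" if "k \<in> A" for k using ds that by (simp add: internal_direct_sum_def)
  then have sg: "subgroup (N k) (add_monoid M)" if "k \<in> A" for k
    using that by (simp add: submodule_def)
  have z: "\<zero>\<^bsub>M\<^esub> \<in> N k" if "k \<in> A" for k using subgroup.one_closed[OF sg[OF that]] by simp
  obtain x where x: "x \<in> N i" "x \<noteq> \<zero>\<^bsub>M\<^esub>" using z[OF ij(1)] nz[OF ij(1)] by blast
  have xc: "x \<in> carrier M" using subgroup.subset[OF sg[OF ij(1)]] x by auto
  define g where "g k = (\<lambda>l \<in> A. if l = k then x else \<zero>\<^bsub>M\<^esub>)" for k
  have supp: "{l \<in> A. g k l \<noteq> \<zero>\<^bsub>M\<^esub>} = {k}" if "k \<in> A" for k using that x by (auto simp: g_def)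
  have sum: "x = (\<Oplus>\<^bsub>M\<^esub> l \<in> {k}. g k l)" if "k \<in> A" for k
    using that xc by (simp add: g_def)
  have P: "g k \<in> (\<Pi>\<^sub>E l \<in> A. N l) \<and> finite {l \<in> A. g k l \<noteq> \<zero>\<^bsub>M\<^esub>} \<and>
      x = (\<Oplus>\<^bsub>M\<^esub> l \<in> {l \<in> A. g k l \<noteq> \<zero>\<^bsub>M\<^esub>}. g k l)" if "k = i \<or> k = j" for k
  proof -
    have k: "k \<in> A" "x \<in> N k" using that ij x by auto
    have "g k \<in> (\<Pi>\<^sub>E l \<in> A. N l)" using k z by (auto simp: g_def)
    then show ?thesis unfolding supp[OF k(1)] using sum[OF k(1)] by blast
  qed
  have "\<exists>!f. f \<in> (\<Pi>\<^sub>E l \<in> A. N l) \<and> finite {l \<in> A. f l \<noteq> \<zero>\<^bsub>M\<^esub>} \<and>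
      x = (\<Oplus>\<^bsub>M\<^esub> l \<in> {l \<in> A. f l \<noteq> \<zero>\<^bsub>M\<^esub>}. f l)"
    using ds xc by (simp only: internal_direct_sum_def)
  then have "g i = g j" by (rule Ex1_unique) (rule P, simp)+
  then have "g i i = g j i" by simp
  then show False using ij x by (simp add: g_def)
qed

lemma (in left_module) indexed_decomposition_iff:
  fixes A :: "'i set"
  shows "internal_direct_sum R M A N \<and> (\<forall>i \<in> A. N i \<noteq> {\<zero>\<^bsub>M\<^esub>}) \<longleftrightarrow>
    inj_on N A \<and> decomposition R M (N ` A)"
proof -
  have eq: "internal_direct_sum R M A N \<longleftrightarrow> internal_direct_sum R M (N ` A) (\<lambda>K. K)"
    if inj: "inj_on N A"
  proof (cases "\<forall>i \<in> A. submodule (N i) R M")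
    case True
    then have sub: "N i \<subseteq> carrier M" if "i \<in> A" for i
      using that subgroup.subset[of "N i" "add_monoid M"] by (simp add: submodule_def)
    let ?P = "\<lambda>x f. f \<in> (\<Pi>\<^sub>E i \<in> A. N i) \<and> finite {i \<in> A. f i \<noteq> \<zero>\<^bsub>M\<^esub>} \<and>
        x = (\<Oplus>\<^bsub>M\<^esub> i \<in> {i \<in> A. f i \<noteq> \<zero>\<^bsub>M\<^esub>}. f i)"
    let ?Q = "\<lambda>x f. f \<in> (\<Pi>\<^sub>E K \<in> N ` A. K) \<and> finite {K \<in> N ` A. f K \<noteq> \<zero>\<^bsub>M\<^esub>} \<and>
        x = (\<Oplus>\<^bsub>M\<^esub> K \<in> {K \<in> N ` A. f K \<noteq> \<zero>\<^bsub>M\<^esub>}. f K)"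
    let ?F = "\<lambda>f. \<lambda>i \<in> A. f (N i)"
    let ?G = "\<lambda>f. \<lambda>K \<in> N ` A. f (inv_into A N K)"
    have FP: "?P x (?F f) \<longleftrightarrow> ?Q x f" if f: "f \<in> (\<Pi>\<^sub>E K \<in> N ` A. K)" for x f
    proof -
      have s: "{i \<in> A. ?F f i \<noteq> \<zero>\<^bsub>M\<^esub>} = {i \<in> A. f (N i) \<noteq> \<zero>\<^bsub>M\<^esub>}" by auto
      have "(\<Oplus>\<^bsub>M\<^esub> i \<in> {i \<in> A. f (N i) \<noteq> \<zero>\<^bsub>M\<^esub>}. ?F f i) = (\<Oplus>\<^bsub>M\<^esub> i \<in> {i \<in> A. f (N i) \<noteq> \<zero>\<^bsub>M\<^esub>}. f (N i))"
        using f sub by (intro M.finsum_cong') (fastforce simp: PiE_def Pi_def)+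
      moreover have "?F f \<in> (\<Pi>\<^sub>E i \<in> A. N i)" using f by (auto simp: PiE_def Pi_def)
      ultimately show ?thesis
        using f finsum_reindex_support[OF inj f sub] unfolding s by simp
    qed
    have G: "?G f \<in> (\<Pi>\<^sub>E K \<in> N ` A. K)" "?F (?G f) = f" if "f \<in> (\<Pi>\<^sub>E i \<in> A. N i)" for f
      using that inj by (auto simp: PiE_def Pi_def extensional_def fun_eq_iff)
    have GF: "?G (?F f) = f" if "f \<in> (\<Pi>\<^sub>E K \<in> N ` A. K)" for f
      using that inj by (auto simp: PiE_def Pi_def extensional_def fun_eq_iff)
    have "(\<exists>!f. ?P x f) \<longleftrightarrow> (\<exists>!f. ?Q x f)" for x
      by (rule Ex1_transfer[where F = ?F and G = ?G and X = "\<Pi>\<^sub>E K \<in> N ` A. K"])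
        (erule FP, erule conjunct1, erule conjunct1[THEN G(1)], erule conjunct1[THEN G(2)], erule GF)
    then show ?thesis unfolding internal_direct_sum_def by simp
  next
    case False
    then show ?thesis unfolding internal_direct_sum_def by auto
  qed
  show ?thesis
  proof (cases "inj_on N A")
    case True
    show ?thesis using eq[OF True] True by (simp add: decomposition_def)
  next
    case False
    then show ?thesis using indexed_decomposition_inj[of A N] by blast
  qed
qed

end

theory Submission
  imports Defs
begin

text \<open>
  An indecomposable decomposition is a decomposition, so the first finiteness condition implies the
  second without further ado. For the converse, let a decomposition \<open>D\<close> refine into a finite
  indecomposable decomposition \<open>E\<close>. Then \<open>D\<close> arises from \<open>E\<close> by a partition of the finite set \<open>E\<close>: each
  member of \<open>D\<close> is the sum of the members of \<open>E\<close> in one block. Up to isomorphism there are finitely many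
  choices for \<open>E\<close>, and each has finitely many partitions. The isomorphism class of \<open>D\<close> depends only on
  the partition transported to the chosen representative of \<open>E\<close>, because direct sums of isomorphic
  modules are isomorphic (\<open>module_isomorphic_internal_direct_sum\<close> and
  \<open>decomposition_isomorphic_if_same_partition\<close>).

  Now let \<open>M\<close> be Krull-Schmidt artinian. The descending chain condition makes proper inclusion of direct
  summands of \<open>M\<close> well-founded, and direct summands of direct summands are direct summands; so
  splitting a summand again and again ends with a finite indecomposable decomposition. The same
  condition forces every decomposition of \<open>M\<close> to be finite, since discarding the members of an infinite
  one successively would give an infinite strictly descending chain. Hence the members of a decomposition of \<open>M\<close>
  can be decomposed separately, and by \<open>decomposition_union\<close> the results unite to a finite
  indecomposable decomposition of \<open>M\<close>.

  Internal direct sums are handled throughout by \<open>internal_direct_sum_iff\<close>, which replaces unique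
  expressions of finite support by two conditions on finite sub-families: they span, and they are
  independent.
\<close>

section \<open>Submodules\<close>

lemma (in left_module) submoduleI:
  assumes "H \<subseteq> carrier M" "\<zero>\<^bsub>M\<^esub> \<in> H"
    and "\<And>x. x \<in> H \<Longrightarrow> \<ominus>\<^bsub>M\<^esub> x \<in> H" "\<And>x y. \<lbrakk>x \<in> H; y \<in> H\<rbrakk> \<Longrightarrow> x \<oplus>\<^bsub>M\<^esub> y \<in> H"
    and "\<And>a x. \<lbrakk>a \<in> carrier R; x \<in> H\<rbrakk> \<Longrightarrow> a \<odot>\<^bsub>M\<^esub> x \<in> H"
  shows "submodule H R M"
  using assms by (intro submodule.intro subgroup.intro submodule_axioms.intro) (simp_all add: a_inv_def)

lemma (in left_module) submoduleD:
  assumes "submodule H R M"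
  shows "H \<subseteq> carrier M" "\<zero>\<^bsub>M\<^esub> \<in> H" "\<And>x. x \<in> H \<Longrightarrow> x \<in> carrier M"
    and "\<And>x. x \<in> H \<Longrightarrow> \<ominus>\<^bsub>M\<^esub> x \<in> H" "\<And>x y. \<lbrakk>x \<in> H; y \<in> H\<rbrakk> \<Longrightarrow> x \<oplus>\<^bsub>M\<^esub> y \<in> H"
    and "\<And>a x. \<lbrakk>a \<in> carrier R; x \<in> H\<rbrakk> \<Longrightarrow> a \<odot>\<^bsub>M\<^esub> x \<in> H"
proof -
  interpret submodule H R M by fact
  show "H \<subseteq> carrier M" "\<zero>\<^bsub>M\<^esub> \<in> H" "\<And>x. x \<in> H \<Longrightarrow> x \<in> carrier M"
    and "\<And>x. x \<in> H \<Longrightarrow> \<ominus>\<^bsub>M\<^esub> x \<in> H" "\<And>x y. \<lbrakk>x \<in> H; y \<in> H\<rbrakk> \<Longrightarrow> x \<oplus>\<^bsub>M\<^esub> y \<in> H"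
    using subset one_closed m_inv_closed m_closed by (auto simp: a_inv_def)
  show "\<And>a x. \<lbrakk>a \<in> carrier R; x \<in> H\<rbrakk> \<Longrightarrow> a \<odot>\<^bsub>M\<^esub> x \<in> H" by simp
qed

lemma (in left_module) smult_zero_right: "a \<in> carrier R \<Longrightarrow> a \<odot>\<^bsub>M\<^esub> \<zero>\<^bsub>M\<^esub> = \<zero>\<^bsub>M\<^esub>"
  using smult_r_distr[of a "\<zero>\<^bsub>M\<^esub>" "\<zero>\<^bsub>M\<^esub>"] by (metis M.add.r_cancel_one' M.r_zero M.zero_closed smult_closed)

lemma (in left_module) smult_finsum:
  assumes "finite A" "a \<in> carrier R" "f \<in> A \<rightarrow> carrier M"
  shows "a \<odot>\<^bsub>M\<^esub> (\<Oplus>\<^bsub>M\<^esub> i \<in> A. f i) = (\<Oplus>\<^bsub>M\<^esub> i \<in> A. a \<odot>\<^bsub>M\<^esub> f i)"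
  using assms by (induct set: finite) (simp_all add: Pi_def smult_r_distr smult_zero_right)

lemma (in left_module) finsum_in_submodule:
  assumes N: "submodule N R M" and g: "\<And>i. i \<in> A \<Longrightarrow> g i \<in> N"
  shows "(\<Oplus>\<^bsub>M\<^esub> i \<in> A. g i) \<in> N"
  using g
proof (induct A rule: infinite_finite_induct)
  case (insert i A)
  have "g \<in> A \<rightarrow> carrier M" "g i \<in> carrier M" using insert submoduleD(3)[OF N] by auto
  then show ?case using insert submoduleD(5)[OF N] by simp
qed (simp_all add: submoduleD(2)[OF N])

lemma (in left_module) left_module_submodule_structure:
  assumes N: "submodule N R M"
  shows "left_module R (submodule_structure M N)"
proof -
  note D = submoduleD[OF N]
  have "abelian_group (submodule_structure M N)"
  proof (rule abelian_groupI)
    show "\<exists>y \<in> carrier (submodule_structure M N). y \<oplus>\<^bsub>submodule_structure M N\<^esub> x = \<zero>\<^bsub>submodule_structure M N\<^esub>"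
      if "x \<in> carrier (submodule_structure M N)" for x
      using that D by (intro bexI[of _ "\<ominus>\<^bsub>M\<^esub> x"]) (auto simp: M.l_neg)
  qed (use D in \<open>auto simp: M.a_ac\<close>)
  then show ?thesis
    using D by (auto intro!: left_module.intro left_module_axioms.intro R.ring_axioms
      simp: smult_l_distr smult_r_distr smult_assoc1)
qed

lemma (in left_module) submodule_submodule_structure_iff:
  assumes N: "submodule N R M"
  shows "submodule K R (submodule_structure M N) \<longleftrightarrow> submodule K R M \<and> K \<subseteq> N"
proof
  interpret N: left_module R "submodule_structure M N" using N by (rule left_module_submodule_structure)
  have inv: "\<ominus>\<^bsub>submodule_structure M N\<^esub> x = \<ominus>\<^bsub>M\<^esub> x" if "x \<in> N" for x
    using submoduleD[OF N] that N.minus_equality[of "\<ominus>\<^bsub>M\<^esub> x" x] by (simp add: M.l_neg)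
  {
    assume K: "submodule K R (submodule_structure M N)"
    note D = N.submoduleD[OF K]
    have "submodule K R M"
      using D submoduleD(1)[OF N] inv by (intro submoduleI) (auto simp: subset_iff)
    then show "submodule K R M \<and> K \<subseteq> N" using D(1) by simp
  next
    assume K: "submodule K R M \<and> K \<subseteq> N"
    with submoduleD[of K] inv show "submodule K R (submodule_structure M N)"
      by (intro N.submoduleI) (auto simp: subset_iff)
  }
qed

lemma (in left_module) finsum_submodule_structure:
  assumes N: "submodule N R M" and g: "\<And>i. i \<in> A \<Longrightarrow> g i \<in> N"
  shows "(\<Oplus>\<^bsub>submodule_structure M N\<^esub> i \<in> A. g i) = (\<Oplus>\<^bsub>M\<^esub> i \<in> A. g i)"
  using g
proof (induct A rule: infinite_finite_induct)
  interpret N: left_module R "submodule_structure M N" using N by (rule left_module_submodule_structure)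
  {
    case (infinite A)
    then show ?case by simp
  next
    case empty
    show ?case by simp
  next
    case (insert i A)
    have "g \<in> A \<rightarrow> N" "g i \<in> N" "g \<in> A \<rightarrow> carrier M" "g i \<in> carrier M"
      using insert submoduleD(3)[OF N] by auto
    with insert show ?case by simp
  }
qed

lemma (in left_module) submodule_carrier: "submodule (carrier M) R M"
  by (rule submoduleI) auto

lemma set_add_submodule_structure: "K <+>\<^bsub>submodule_structure M N\<^esub> L = K <+>\<^bsub>M\<^esub> L"
  by (simp add: set_add_def')

lemma mem_set_add_iff: "x \<in> K <+>\<^bsub>M\<^esub> L \<longleftrightarrow> (\<exists>k \<in> K. \<exists>l \<in> L. x = k \<oplus>\<^bsub>M\<^esub> l)"
  by (simp add: set_add_def')

lemma (in left_module) submodule_set_add: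
  assumes K: "submodule K R M" and L: "submodule L R M"
  shows "submodule (K <+>\<^bsub>M\<^esub> L) R M"
proof (rule submoduleI)
  note D = submoduleD[OF K] submoduleD[OF L]
  have I: "k \<oplus>\<^bsub>M\<^esub> l \<in> K <+>\<^bsub>M\<^esub> L" if "k \<in> K" "l \<in> L" for k l
    using that by (auto simp: mem_set_add_iff)
  show "K <+>\<^bsub>M\<^esub> L \<subseteq> carrier M" using D(3,9) by (auto simp: mem_set_add_iff)
  show "\<zero>\<^bsub>M\<^esub> \<in> K <+>\<^bsub>M\<^esub> L" using I[OF D(2,8)] by simp
  fix x assume "x \<in> K <+>\<^bsub>M\<^esub> L"
  then obtain k l where x: "k \<in> K" "l \<in> L" "x = k \<oplus>\<^bsub>M\<^esub> l" by (auto simp: mem_set_add_iff)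
  note xc = D(3)[OF x(1)] D(9)[OF x(2)]
  show "\<ominus>\<^bsub>M\<^esub> x \<in> K <+>\<^bsub>M\<^esub> L"
    using I[OF D(4)[OF x(1)] D(10)[OF x(2)]] x(3) xc by (simp add: M.minus_add)
  show "a \<odot>\<^bsub>M\<^esub> x \<in> K <+>\<^bsub>M\<^esub> L" if a: "a \<in> carrier R" for a
    using I[OF D(6)[OF a x(1)] D(12)[OF a x(2)]] x(3) xc a by (simp add: smult_r_distr)
  fix y assume "y \<in> K <+>\<^bsub>M\<^esub> L"
  then obtain k' l' where y: "k' \<in> K" "l' \<in> L" "y = k' \<oplus>\<^bsub>M\<^esub> l'" by (auto simp: mem_set_add_iff)
  have "x \<oplus>\<^bsub>M\<^esub> y = (k \<oplus>\<^bsub>M\<^esub> k') \<oplus>\<^bsub>M\<^esub> (l \<oplus>\<^bsub>M\<^esub> l')"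
    using xc D(3)[OF y(1)] D(9)[OF y(2)] unfolding x(3) y(3) by (simp add: M.a_ac)
  then show "x \<oplus>\<^bsub>M\<^esub> y \<in> K <+>\<^bsub>M\<^esub> L" using I[OF D(5)[OF x(1) y(1)] D(11)[OF x(2) y(2)]] by simp
qed

section \<open>Sums of submodules and independence\<close>

text \<open>A sum indexed by a finite subset \<open>F\<close> of \<open>B\<close> with one term in each member of \<open>F\<close>: avoiding choice
  functions on all of \<open>B\<close>, and hence supports, makes finite sub-families easy to recombine.\<close>

definition submodule_sum :: "('a, 'b, 'n) module_scheme \<Rightarrow> 'b set set \<Rightarrow> 'b set" where
  "submodule_sum M B =
     {\<Oplus>\<^bsub>M\<^esub> K \<in> F. g K | F g. finite F \<and> F \<subseteq> B \<and> (\<forall>K \<in> F. g K \<in> K)}"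

definition independent_submodules :: "('a, 'b, 'n) module_scheme \<Rightarrow> 'b set set \<Rightarrow> bool" where
  "independent_submodules M B \<longleftrightarrow>
     (\<forall>F g. finite F \<longrightarrow> F \<subseteq> B \<longrightarrow> (\<forall>K \<in> F. g K \<in> K) \<longrightarrow> (\<Oplus>\<^bsub>M\<^esub> K \<in> F. g K) = \<zero>\<^bsub>M\<^esub> \<longrightarrow>
        (\<forall>K \<in> F. g K = \<zero>\<^bsub>M\<^esub>))"

lemma submodule_sumI:
  "\<lbrakk>finite F; F \<subseteq> B; \<And>K. K \<in> F \<Longrightarrow> g K \<in> K\<rbrakk> \<Longrightarrow> (\<Oplus>\<^bsub>M\<^esub> K \<in> F. g K) \<in> submodule_sum M B"
  by (auto simp: submodule_sum_def)

lemma submodule_sumE: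
  assumes "x \<in> submodule_sum M B"
  obtains F g where "finite F" "F \<subseteq> B" "\<And>K. K \<in> F \<Longrightarrow> g K \<in> K" "x = (\<Oplus>\<^bsub>M\<^esub> K \<in> F. g K)"
  using assms by (auto simp: submodule_sum_def)

lemma independent_submodulesD:
  "\<lbrakk>independent_submodules M B; finite F; F \<subseteq> B; \<And>K. K \<in> F \<Longrightarrow> g K \<in> K;
    (\<Oplus>\<^bsub>M\<^esub> K \<in> F. g K) = \<zero>\<^bsub>M\<^esub>; K \<in> F\<rbrakk> \<Longrightarrow> g K = \<zero>\<^bsub>M\<^esub>"
  unfolding independent_submodules_def by blast

lemma submodule_sum_mono: "B \<subseteq> C \<Longrightarrow> submodule_sum M B \<subseteq> submodule_sum M C"
  by (fastforce simp: submodule_sum_def)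

lemma independent_submodules_mono:
  "independent_submodules M C \<Longrightarrow> B \<subseteq> C \<Longrightarrow> independent_submodules M B"
  unfolding independent_submodules_def by (meson subset_trans)

lemma (in left_module) finsum_extend_zero:
  assumes "finite G" "F \<subseteq> G" "\<And>i. i \<in> F \<Longrightarrow> g i \<in> carrier M"
  shows "(\<Oplus>\<^bsub>M\<^esub> i \<in> G. if i \<in> F then g i else \<zero>\<^bsub>M\<^esub>) = (\<Oplus>\<^bsub>M\<^esub> i \<in> F. g i)"
  using assms by (intro M.add.finprod_mono_neutral_cong_right) auto

lemma (in left_module) summand_subset_submodule_sum:
  assumes "submodule K R M" "K \<in> B"
  shows "K \<subseteq> submodule_sum M B"
proof
  fix x assume x: "x \<in> K"
  then have "x = (\<Oplus>\<^bsub>M\<^esub> L \<in> {K}. x)" using submoduleD(3)[OF assms(1)] by simp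
  then show "x \<in> submodule_sum M B" using x assms(2) submodule_sumI[of "{K}" B "\<lambda>_. x" M] by simp
qed

lemma (in left_module) submodule_sum_least:
  assumes "submodule N R M" "\<And>K. K \<in> B \<Longrightarrow> K \<subseteq> N"
  shows "submodule_sum M B \<subseteq> N"
proof
  fix x assume "x \<in> submodule_sum M B"
  then obtain F g where "finite F" "F \<subseteq> B" "\<And>K. K \<in> F \<Longrightarrow> g K \<in> K" "x = (\<Oplus>\<^bsub>M\<^esub> K \<in> F. g K)"
    by (rule submodule_sumE) blast
  then show "x \<in> N" using assms by (auto intro!: finsum_in_submodule)
qed

lemma (in left_module) submodule_submodule_sum:
  assumes B: "\<And>K. K \<in> B \<Longrightarrow> submodule K R M"
  shows "submodule (submodule_sum M B) R M"
proof (rule submoduleI)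
  show sub: "submodule_sum M B \<subseteq> carrier M"
    using submodule_carrier by (rule submodule_sum_least) (use B submoduleD(1) in blast)
  show "\<zero>\<^bsub>M\<^esub> \<in> submodule_sum M B" using submodule_sumI[of "{}" B undefined M] by simp
  show "a \<odot>\<^bsub>M\<^esub> x \<in> submodule_sum M B" if a: "a \<in> carrier R" and x: "x \<in> submodule_sum M B" for a x
  proof -
    obtain F g where F: "finite F" "F \<subseteq> B" "\<And>K. K \<in> F \<Longrightarrow> g K \<in> K" "x = (\<Oplus>\<^bsub>M\<^esub> K \<in> F. g K)"
      using x by (rule submodule_sumE) blast
    have "g \<in> F \<rightarrow> carrier M" using F submoduleD(3)[OF B] by blast
    then have "a \<odot>\<^bsub>M\<^esub> x = (\<Oplus>\<^bsub>M\<^esub> K \<in> F. a \<odot>\<^bsub>M\<^esub> g K)" using F a by (simp add: smult_finsum)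
    moreover have "(\<Oplus>\<^bsub>M\<^esub> K \<in> F. a \<odot>\<^bsub>M\<^esub> g K) \<in> submodule_sum M B"
      using F(1,2)
    proof (rule submodule_sumI)
      show "a \<odot>\<^bsub>M\<^esub> g K \<in> K" if "K \<in> F" for K using F(2,3) a that B submoduleD(6) by blast
    qed
    ultimately show ?thesis by simp
  qed
  show "\<ominus>\<^bsub>M\<^esub> x \<in> submodule_sum M B" if x: "x \<in> submodule_sum M B" for x
  proof -
    obtain F g where F: "finite F" "F \<subseteq> B" "\<And>K. K \<in> F \<Longrightarrow> g K \<in> K" "x = (\<Oplus>\<^bsub>M\<^esub> K \<in> F. g K)"
      using x by (rule submodule_sumE) blast
    have c: "g K \<in> carrier M" if "K \<in> F" for K using F(2,3) submoduleD(3)[OF B] that by blast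
    let ?y = "\<Oplus>\<^bsub>M\<^esub> K \<in> F. \<ominus>\<^bsub>M\<^esub> g K"
    have "?y \<oplus>\<^bsub>M\<^esub> x = (\<Oplus>\<^bsub>M\<^esub> K \<in> F. \<ominus>\<^bsub>M\<^esub> g K \<oplus>\<^bsub>M\<^esub> g K)"
      unfolding F(4) using c by (intro M.finsum_addf[symmetric]) auto
    also have "\<dots> = \<zero>\<^bsub>M\<^esub>" using c by (intro M.add.finprod_one_eqI) (simp add: M.l_neg)
    finally have "\<ominus>\<^bsub>M\<^esub> x = ?y" using x sub c by (intro M.minus_equality) auto
    moreover have "?y \<in> submodule_sum M B"
      using F(1,2,3) submoduleD(4)[OF B] by (intro submodule_sumI) auto
    ultimately show ?thesis by simp
  qed
  show "x \<oplus>\<^bsub>M\<^esub> y \<in> submodule_sum M B" if x: "x \<in> submodule_sum M B" and y: "y \<in> submodule_sum M B" for x y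
  proof -
    obtain F f where F: "finite F" "F \<subseteq> B" "\<And>K. K \<in> F \<Longrightarrow> f K \<in> K" "x = (\<Oplus>\<^bsub>M\<^esub> K \<in> F. f K)"
      using x by (rule submodule_sumE) blast
    obtain G g where G: "finite G" "G \<subseteq> B" "\<And>K. K \<in> G \<Longrightarrow> g K \<in> K" "y = (\<Oplus>\<^bsub>M\<^esub> K \<in> G. g K)"
      using y by (rule submodule_sumE) blast
    let ?f = "\<lambda>K. if K \<in> F then f K else \<zero>\<^bsub>M\<^esub>"
    let ?g = "\<lambda>K. if K \<in> G then g K else \<zero>\<^bsub>M\<^esub>"
    have c: "f K \<in> carrier M" if "K \<in> F" for K using F(2,3) submoduleD(3)[OF B] that by blast
    have d: "g K \<in> carrier M" if "K \<in> G" for K using G(2,3) submoduleD(3)[OF B] that by blast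
    have "x \<oplus>\<^bsub>M\<^esub> y = (\<Oplus>\<^bsub>M\<^esub> K \<in> F \<union> G. ?f K) \<oplus>\<^bsub>M\<^esub> (\<Oplus>\<^bsub>M\<^esub> K \<in> F \<union> G. ?g K)"
      using F G c d by (simp only: finsum_extend_zero finite_Un Un_upper1 Un_upper2)
    also have "\<dots> = (\<Oplus>\<^bsub>M\<^esub> K \<in> F \<union> G. ?f K \<oplus>\<^bsub>M\<^esub> ?g K)"
      using c d by (intro M.finsum_addf[symmetric]) auto
    also have "\<dots> \<in> submodule_sum M B"
    proof (rule submodule_sumI)
      show "?f K \<oplus>\<^bsub>M\<^esub> ?g K \<in> K" if "K \<in> F \<union> G" for K
      proof -
        have "submodule K R M" using that F(2) G(2) B by blast
        note D = submoduleD[OF this]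
        show ?thesis using F(3) G(3) D(2) by (intro D(5)) auto
      qed
    qed (use F G in auto)
    finally show ?thesis .
  qed
qed

lemma (in left_module) submodule_sum_singleton: "submodule K R M \<Longrightarrow> submodule_sum M {K} = K"
  using summand_subset_submodule_sum[of K "{K}"] submodule_sum_least[of K "{K}"] by auto

text \<open>A common element of the two sums gives a relation among the members of \<open>B \<union> C\<close>: an expression of it
  over \<open>B\<close> plus an expression of its negative over \<open>C\<close>. As \<open>B\<close> and \<open>C\<close> have no common member, no terms
  merge, so independence makes every term vanish.\<close>

lemma (in left_module) independent_submodules_disjoint_sums:
  assumes ind: "independent_submodules M (B \<union> C)" and disj: "B \<inter> C = {}"
    and sm: "\<And>K. K \<in> B \<union> C \<Longrightarrow> submodule K R M"
  shows "submodule_sum M B \<inter> submodule_sum M C = {\<zero>\<^bsub>M\<^esub>}"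
proof -
  have sB: "submodule (submodule_sum M B) R M" and sC: "submodule (submodule_sum M C) R M"
    using sm by (auto intro!: submodule_submodule_sum)
  have "x = \<zero>\<^bsub>M\<^esub>" if x: "x \<in> submodule_sum M B" "x \<in> submodule_sum M C" for x
  proof -
    obtain F f where F: "finite F" "F \<subseteq> B" "\<And>K. K \<in> F \<Longrightarrow> f K \<in> K" "x = (\<Oplus>\<^bsub>M\<^esub> K \<in> F. f K)"
      using x(1) by (rule submodule_sumE) blast
    obtain G g where G: "finite G" "G \<subseteq> C" "\<And>K. K \<in> G \<Longrightarrow> g K \<in> K" "\<ominus>\<^bsub>M\<^esub> x = (\<Oplus>\<^bsub>M\<^esub> K \<in> G. g K)"
      using submoduleD(4)[OF sC x(2)] by (rule submodule_sumE) blast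
    let ?h = "\<lambda>K. if K \<in> F then f K else g K"
    have FG: "F \<inter> G = {}" using F(2) G(2) disj by blast
    have h: "?h K \<in> K" if "K \<in> F \<union> G" for K using F(3) G(3) that by auto
    have c: "?h K \<in> carrier M" if K: "K \<in> F \<union> G" for K
    proof -
      have "submodule K R M" using K F(2) G(2) sm by blast
      then show ?thesis using h[OF K] submoduleD(3) by blast
    qed
    have "(\<Oplus>\<^bsub>M\<^esub> K \<in> F \<union> G. ?h K) = (\<Oplus>\<^bsub>M\<^esub> K \<in> F. ?h K) \<oplus>\<^bsub>M\<^esub> (\<Oplus>\<^bsub>M\<^esub> K \<in> G. ?h K)"
      using F(1) G(1) FG c by (intro M.finsum_Un_disjoint) auto
    also have "(\<Oplus>\<^bsub>M\<^esub> K \<in> F. ?h K) = x" 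
      unfolding F(4) using c by (intro M.finsum_cong') force+
    also have "(\<Oplus>\<^bsub>M\<^esub> K \<in> G. ?h K) = \<ominus>\<^bsub>M\<^esub> x"
    proof -
      have "g \<in> G \<rightarrow> carrier M" using c FG by (metis (mono_tags) IntI Pi_I UnCI emptyE)
      then show ?thesis unfolding G(4) using FG by (intro M.finsum_cong') auto
    qed
    also have "x \<oplus>\<^bsub>M\<^esub> \<ominus>\<^bsub>M\<^esub> x = \<zero>\<^bsub>M\<^esub>" using submoduleD(3)[OF sB x(1)] by (rule M.r_neg)
    finally have rel: "(\<Oplus>\<^bsub>M\<^esub> K \<in> F \<union> G. ?h K) = \<zero>\<^bsub>M\<^esub>" .
    have "F \<union> G \<subseteq> B \<union> C" using F(2) G(2) by blast
    then have "?h K = \<zero>\<^bsub>M\<^esub>" if "K \<in> F \<union> G" for K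
      using independent_submodulesD[OF ind _ _ h rel that] F(1) G(1) by blast
    then have "f K = \<zero>\<^bsub>M\<^esub>" if "K \<in> F" for K using that by (metis UnI1)
    then show "x = \<zero>\<^bsub>M\<^esub>" unfolding F(4) by (intro M.add.finprod_one_eqI)
  qed
  then show ?thesis using submoduleD(2)[OF sB] submoduleD(2)[OF sC] by blast
qed

text \<open>Existence of expressions is spanning. Uniqueness of all expressions reduces to uniqueness of the
  expression of zero by subtracting two expressions over the union of their supports.\<close>

lemma (in left_module) internal_direct_sum_iff:
  "internal_direct_sum R M D (\<lambda>K. K) \<longleftrightarrow>
     (\<forall>K \<in> D. submodule K R M) \<and> submodule_sum M D = carrier M \<and> independent_submodules M D"
  (is "?L \<longleftrightarrow> ?sub \<and> ?span \<and> ?ind")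
proof (cases ?sub)
  case sub: True
  let ?S = "\<lambda>f. {K \<in> D. f K \<noteq> \<zero>\<^bsub>M\<^esub>}"
  let ?Q = "\<lambda>x f. f \<in> (\<Pi>\<^sub>E K \<in> D. K) \<and> finite (?S f) \<and> x = (\<Oplus>\<^bsub>M\<^esub> K \<in> ?S f. f K)"
  note zero = submoduleD(2)[OF sub[rule_format]]
  have car: "g K \<in> carrier M" if "K \<in> F" "F \<subseteq> D" "\<And>K. K \<in> F \<Longrightarrow> g K \<in> K" for F g K
    using submoduleD(3)[OF sub[rule_format]] that by blast
  \<comment> \<open>every finite expression is the sum over the support of its extension by zero to \<open>D\<close>\<close>
  have ext: "?Q (\<Oplus>\<^bsub>M\<^esub> K \<in> F. g K) (\<lambda>K \<in> D. if K \<in> F then g K else \<zero>\<^bsub>M\<^esub>)"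
    if F: "finite F" "F \<subseteq> D" "\<And>K. K \<in> F \<Longrightarrow> g K \<in> K" for F g
  proof -
    let ?f = "\<lambda>K \<in> D. if K \<in> F then g K else \<zero>\<^bsub>M\<^esub>"
    have S: "?S ?f \<subseteq> F" using F(2) by (auto split: if_splits)
    have "(\<Oplus>\<^bsub>M\<^esub> K \<in> F. g K) = (\<Oplus>\<^bsub>M\<^esub> K \<in> ?S ?f. ?f K)"
      using F S car[of _ F g] by (intro M.add.finprod_mono_neutral_cong_right) auto
    moreover have "?f \<in> (\<Pi>\<^sub>E K \<in> D. K)" using F(3) zero by auto
    ultimately show ?thesis using finite_subset[OF S F(1)] by blast
  qed
  have L: "?L \<longleftrightarrow> (\<forall>x \<in> carrier M. \<exists>!f. ?Q x f)" using sub by (simp add: internal_direct_sum_def)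
  have "?L \<longleftrightarrow> ?span \<and> ?ind"
  proof (intro iffI conjI)
    assume ?L
    then have ex1: "\<exists>!f. ?Q x f" if "x \<in> carrier M" for x using L that by blast
    show ?span
    proof
      show "submodule_sum M D \<subseteq> carrier M"
        using submodule_submodule_sum sub submoduleD(1) by blast
      show "carrier M \<subseteq> submodule_sum M D"
      proof
        fix x assume "x \<in> carrier M"
        then obtain f where "?Q x f" using ex1 by blast
        then show "x \<in> submodule_sum M D" by (auto intro: submodule_sumI)
      qed
    qed
    show ?ind unfolding independent_submodules_def
    proof (intro allI impI ballI)
      fix F g K assume F: "finite F" "F \<subseteq> D" "\<forall>K \<in> F. g K \<in> K"
        and rel: "(\<Oplus>\<^bsub>M\<^esub> K \<in> F. g K) = \<zero>\<^bsub>M\<^esub>" and K: "K \<in> F"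
      have "?Q \<zero>\<^bsub>M\<^esub> (\<lambda>K \<in> D. if K \<in> F then g K else \<zero>\<^bsub>M\<^esub>)" using ext[of F g] F rel by simp
      moreover have "?Q \<zero>\<^bsub>M\<^esub> (\<lambda>K \<in> D. \<zero>\<^bsub>M\<^esub>)" using ext[of "{}" g] by simp
      ultimately have "(\<lambda>K \<in> D. if K \<in> F then g K else \<zero>\<^bsub>M\<^esub>) = (\<lambda>K \<in> D. \<zero>\<^bsub>M\<^esub>)"
        by (rule Ex1_unique[OF ex1[OF M.zero_closed]])
      from fun_cong[OF this, of K] show "g K = \<zero>\<^bsub>M\<^esub>" using K F(2) by auto
    qed
  next
    assume SI: "?span \<and> ?ind"
    show ?L unfolding L
    proof (intro ballI ex_ex1I)
      fix x assume "x \<in> carrier M"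
      then have "x \<in> submodule_sum M D" using SI by simp
      then obtain F g where F: "finite F" "F \<subseteq> D" "\<And>K. K \<in> F \<Longrightarrow> g K \<in> K" "x = (\<Oplus>\<^bsub>M\<^esub> K \<in> F. g K)"
        by (rule submodule_sumE) blast
      then show "\<exists>f. ?Q x f" using ext[OF F(1-3)] by blast
    next
      fix x f g assume x: "x \<in> carrier M" and f: "?Q x f" and g: "?Q x g"
      let ?F = "?S f \<union> ?S g"
      have F: "finite ?F" "?F \<subseteq> D" using f g by auto
      have fc: "f K \<in> carrier M" "g K \<in> carrier M" if "K \<in> D" for K
        using f g that submoduleD(3)[OF sub[rule_format, OF that]] by auto
      have sums: "x = (\<Oplus>\<^bsub>M\<^esub> K \<in> ?F. f K)" "x = (\<Oplus>\<^bsub>M\<^esub> K \<in> ?F. g K)"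
      proof -
        have "(\<Oplus>\<^bsub>M\<^esub> K \<in> ?S f. f K) = (\<Oplus>\<^bsub>M\<^esub> K \<in> ?F. f K)"
          by (rule M.add.finprod_mono_neutral_cong_left[OF F(1)]) (use fc in auto)
        moreover have "(\<Oplus>\<^bsub>M\<^esub> K \<in> ?S g. g K) = (\<Oplus>\<^bsub>M\<^esub> K \<in> ?F. g K)"
          by (rule M.add.finprod_mono_neutral_cong_left[OF F(1)]) (use fc in auto)
        ultimately show "x = (\<Oplus>\<^bsub>M\<^esub> K \<in> ?F. f K)" "x = (\<Oplus>\<^bsub>M\<^esub> K \<in> ?F. g K)" using f g by auto
      qed
      have "(\<Oplus>\<^bsub>M\<^esub> K \<in> ?F. f K) = (\<Oplus>\<^bsub>M\<^esub> K \<in> ?F. f K \<ominus>\<^bsub>M\<^esub> g K) \<oplus>\<^bsub>M\<^esub> (\<Oplus>\<^bsub>M\<^esub> K \<in> ?F. g K)"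
      proof -
        have "(\<Oplus>\<^bsub>M\<^esub> K \<in> ?F. f K) = (\<Oplus>\<^bsub>M\<^esub> K \<in> ?F. (f K \<ominus>\<^bsub>M\<^esub> g K) \<oplus>\<^bsub>M\<^esub> g K)"
          using fc by (intro M.finsum_cong') (auto simp: M.minus_eq M.a_assoc M.l_neg)
        also have "\<dots> = (\<Oplus>\<^bsub>M\<^esub> K \<in> ?F. f K \<ominus>\<^bsub>M\<^esub> g K) \<oplus>\<^bsub>M\<^esub> (\<Oplus>\<^bsub>M\<^esub> K \<in> ?F. g K)"
          using fc by (intro M.finsum_addf) auto
        finally show ?thesis .
      qed
      then have "x = (\<Oplus>\<^bsub>M\<^esub> K \<in> ?F. f K \<ominus>\<^bsub>M\<^esub> g K) \<oplus>\<^bsub>M\<^esub> x"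
        by (simp only: sums[symmetric])
      moreover have "(\<Oplus>\<^bsub>M\<^esub> K \<in> ?F. f K \<ominus>\<^bsub>M\<^esub> g K) \<in> carrier M"
        using fc by (intro M.finsum_closed) auto
      ultimately have rel: "(\<Oplus>\<^bsub>M\<^esub> K \<in> ?F. f K \<ominus>\<^bsub>M\<^esub> g K) = \<zero>\<^bsub>M\<^esub>"
        using x by simp
      have mem: "f K \<ominus>\<^bsub>M\<^esub> g K \<in> K" if "K \<in> ?F" for K
      proof -
        have K: "K \<in> D" using that by blast
        note D = submoduleD[OF sub[rule_format, OF K]]
        have "f K \<in> K" "g K \<in> K" using f g K by auto
        then show ?thesis unfolding M.minus_eq by (intro D(4,5))
      qed
      have "f K \<ominus>\<^bsub>M\<^esub> g K = \<zero>\<^bsub>M\<^esub>" if "K \<in> ?F" for K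
        using independent_submodulesD[OF conjunct2[OF SI] F mem rel that] .
      then have "f K = g K" if "K \<in> ?F" for K
        using M.minus_equality[of "f K" "\<ominus>\<^bsub>M\<^esub> g K"] fc that by (auto simp: M.minus_eq)
      then have eq: "f K = g K" if "K \<in> D" for K using that by fastforce
      show "f = g"
      proof (rule PiE_ext)
        show "f \<in> (\<Pi>\<^sub>E K \<in> D. K)" "g \<in> (\<Pi>\<^sub>E K \<in> D. K)" using f g by auto
        show "f K = g K" if "K \<in> D" for K using eq[OF that] .
      qed
    qed
  qed
  then show ?thesis using sub by blast
qed (auto simp: internal_direct_sum_def)

section \<open>Decompositions\<close>

lemma (in left_module) decomposition_iff:
  "decomposition R M D \<longleftrightarrow>
     (\<forall>K \<in> D. submodule K R M \<and> K \<noteq> {\<zero>\<^bsub>M\<^esub>}) \<and> submodule_sum M D = carrier M \<and>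
     independent_submodules M D"
  unfolding decomposition_def internal_direct_sum_iff by blast

lemma (in left_module) submodule_sum_submodule_structure:
  assumes N: "submodule N R M" and B: "\<And>K. K \<in> B \<Longrightarrow> K \<subseteq> N"
  shows "submodule_sum (submodule_structure M N) B = submodule_sum M B"
proof -
  have "(\<Oplus>\<^bsub>submodule_structure M N\<^esub> K \<in> F. g K) = (\<Oplus>\<^bsub>M\<^esub> K \<in> F. g K)"
    if "F \<subseteq> B" "\<forall>K \<in> F. g K \<in> K" for F g
    using that B by (intro finsum_submodule_structure[OF N]) blast
  then show ?thesis unfolding submodule_sum_def by (metis (no_types, lifting))
qed

lemma (in left_module) independent_submodules_submodule_structure:
  assumes N: "submodule N R M" and B: "\<And>K. K \<in> B \<Longrightarrow> K \<subseteq> N"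
  shows "independent_submodules (submodule_structure M N) B \<longleftrightarrow> independent_submodules M B"
proof -
  have "(\<Oplus>\<^bsub>submodule_structure M N\<^esub> K \<in> F. g K) = (\<Oplus>\<^bsub>M\<^esub> K \<in> F. g K)"
    if "F \<subseteq> B" "\<forall>K \<in> F. g K \<in> K" for F g
    using that B by (intro finsum_submodule_structure[OF N]) blast
  then show ?thesis unfolding independent_submodules_def by simp
qed

text \<open>Decompositions of a submodule \<open>N\<close> are described inside \<open>M\<close>, so that decompositions of different
  members of a decomposition of \<open>M\<close> can be compared and united. That the members lie in \<open>N\<close> is implied:
  their sum is \<open>N\<close>.\<close>

lemma (in left_module) decomposition_submodule_structure_iff:
  assumes N: "submodule N R M"
  shows "decomposition R (submodule_structure M N) C \<longleftrightarrow>
     (\<forall>K \<in> C. submodule K R M \<and> K \<noteq> {\<zero>\<^bsub>M\<^esub>}) \<and> submodule_sum M C = N \<and> independent_submodules M C"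
proof -
  interpret N: left_module R "submodule_structure M N" using N by (rule left_module_submodule_structure)
  have sub: "K \<subseteq> N" if "\<forall>K \<in> C. submodule K R M" "submodule_sum M C = N" "K \<in> C" for K
    using summand_subset_submodule_sum[of K C] that by auto
  show ?thesis
  proof (cases "\<forall>K \<in> C. K \<subseteq> N")
    case True
    then show ?thesis
      unfolding N.decomposition_iff submodule_submodule_structure_iff[OF N]
      using submodule_sum_submodule_structure[OF N, of C]
        independent_submodules_submodule_structure[OF N, of C] by auto
  next
    case False
    then show ?thesis
      unfolding N.decomposition_iff submodule_submodule_structure_iff[OF N] using sub by blast
  qed
qed

text \<open>A relation among members of the union is grouped into one partial sum for each \<open>N\<close> in \<open>D\<close>.
  Independence of \<open>D\<close> kills each partial sum, and then independence of \<open>C N\<close> kills its terms. The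
  grouping needs the families \<open>C N\<close> to be pairwise disjoint: a submodule in two of them would lie in the
  intersection of two members of \<open>D\<close>, hence be zero.\<close>

lemma (in left_module) decomposition_union:
  assumes D: "decomposition R M D"
    and C: "\<And>N. N \<in> D \<Longrightarrow> decomposition R (submodule_structure M N) (C N)"
  shows "decomposition R M (\<Union>N \<in> D. C N)"
proof -
  let ?E = "\<Union>N \<in> D. C N"
  have sD: "submodule N R M" if "N \<in> D" for N using D that by (simp add: decomposition_iff)
  have sC: "submodule K R M" "K \<noteq> {\<zero>\<^bsub>M\<^esub>}" if "N \<in> D" "K \<in> C N" for N K
    using C[OF that(1)] that(2) by (simp_all add: decomposition_submodule_structure_iff[OF sD[OF that(1)]])
  have sumC: "submodule_sum M (C N) = N" and indC: "independent_submodules M (C N)" if "N \<in> D" for N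
    using C[OF that] by (simp_all add: decomposition_submodule_structure_iff[OF sD[OF that]])
  have subC: "K \<subseteq> N" if "N \<in> D" "K \<in> C N" for N K
    using summand_subset_submodule_sum[of K "C N"] sC that sumC by blast
  have indD: "independent_submodules M D" and sumD: "submodule_sum M D = carrier M"
    using D by (simp_all add: decomposition_iff)
  have disj: "C N \<inter> C N' = {}" if N: "N \<in> D" "N' \<in> D" "N \<noteq> N'" for N N'
  proof (rule ccontr)
    assume "C N \<inter> C N' \<noteq> {}"
    then obtain K where K: "K \<in> C N" "K \<in> C N'" by blast
    have "submodule_sum M {N} \<inter> submodule_sum M {N'} = {\<zero>\<^bsub>M\<^esub>}"
      using N sD by (intro independent_submodules_disjoint_sums independent_submodules_mono[OF indD]) auto
    then have "K \<subseteq> {\<zero>\<^bsub>M\<^esub>}"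
      using subC[OF N(1) K(1)] subC[OF N(2) K(2)] N sD by (auto simp: submodule_sum_singleton)
    then show False using sC[OF N(1) K(1)] submoduleD(2) by blast
  qed
  have sE: "submodule (submodule_sum M ?E) R M" using sC by (intro submodule_submodule_sum) blast
  have "N \<subseteq> submodule_sum M ?E" if "N \<in> D" for N
    using submodule_sum_mono[of "C N" ?E M] sumC[OF that] that by blast
  then have "submodule_sum M D \<subseteq> submodule_sum M ?E" using sE by (intro submodule_sum_least)
  then have sumE: "submodule_sum M ?E = carrier M" using sumD submoduleD(1)[OF sE] by blast
  have "independent_submodules M ?E" unfolding independent_submodules_def
  proof (intro allI impI ballI)
    fix F g K
    assume F: "finite F" "F \<subseteq> ?E" and g: "\<forall>K \<in> F. g K \<in> K"
      and rel: "(\<Oplus>\<^bsub>M\<^esub> K \<in> F. g K) = \<zero>\<^bsub>M\<^esub>" and K: "K \<in> F"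
    \<comment> \<open>\<open>G\<close> is finite: by disjointness, a choice of a member of \<open>C N \<inter> F\<close> for each \<open>N\<close> is injective\<close>
    define G where "G = {N \<in> D. C N \<inter> F \<noteq> {}}"
    have "\<forall>N \<in> G. \<exists>L. L \<in> C N \<inter> F" by (auto simp: G_def)
    then obtain l where l: "\<And>N. N \<in> G \<Longrightarrow> l N \<in> C N \<inter> F" by metis
    have "inj_on l G" using l disj unfolding inj_on_def G_def by (metis (no_types, lifting) IntE IntI emptyE mem_Collect_eq)
    moreover have "l ` G \<subseteq> F" using l by blast
    ultimately have G: "finite G" using F(1) by (meson finite_imageD finite_subset)
    have UN: "F = (\<Union>N \<in> G. C N \<inter> F)" using F(2) unfolding G_def by blast
    have gN: "g L \<in> N" if "N \<in> D" "L \<in> C N" "L \<in> F" for N L using subC that g by blast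
    have "(\<Oplus>\<^bsub>M\<^esub> N \<in> G. \<Oplus>\<^bsub>M\<^esub> L \<in> C N \<inter> F. g L) = (\<Oplus>\<^bsub>M\<^esub> L \<in> (\<Union>N \<in> G. C N \<inter> F). g L)"
    proof (rule M.add.finprod_UN_disjoint[symmetric])
      show "pairwise (\<lambda>N N'. disjnt (C N \<inter> F) (C N' \<inter> F)) G"
        using disj unfolding pairwise_def disjnt_def G_def by blast
      show "g L \<in> carrier M" if "N \<in> G" "L \<in> C N \<inter> F" for N L
        using that gN[of N L] submoduleD(3)[OF sD] unfolding G_def by blast
    qed (use F G in auto)
    also have "\<dots> = \<zero>\<^bsub>M\<^esub>" using rel UN by simp
    finally have rel': "(\<Oplus>\<^bsub>M\<^esub> N \<in> G. \<Oplus>\<^bsub>M\<^esub> L \<in> C N \<inter> F. g L) = \<zero>\<^bsub>M\<^esub>" .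
    obtain N where N: "N \<in> D" "K \<in> C N" using F(2) K by blast
    then have NG: "N \<in> G" using K by (auto simp: G_def)
    have "(\<Oplus>\<^bsub>M\<^esub> L \<in> C N \<inter> F. g L) = \<zero>\<^bsub>M\<^esub>"
    proof (rule independent_submodulesD[OF indD G _ _ rel' NG])
      show "G \<subseteq> D" by (auto simp: G_def)
      show "(\<Oplus>\<^bsub>M\<^esub> L \<in> C N \<inter> F. g L) \<in> N" if "N \<in> G" for N
        using that gN sD unfolding G_def by (intro finsum_in_submodule) auto
    qed
    then show "g K = \<zero>\<^bsub>M\<^esub>"
      using F(1) N K g by (intro independent_submodulesD[OF indC[OF N(1)], of "C N \<inter> F" g]) auto
  qed
  then show ?thesis unfolding decomposition_iff using sC sumE by blast
qed

section \<open>Isomorphic direct sums\<close>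

lemma module_isomorphic_refl: "module_isomorphic R M M"
  unfolding module_isomorphic_def by (rule bexI[OF _ iso_set_refl]) simp

lemma (in left_module) module_isomorphic_sym:
  assumes "module_isomorphic R M N"
  shows "module_isomorphic R N M"
proof -
  obtain h where h: "h \<in> iso (add_monoid M) (add_monoid N)"
    and lin: "\<And>a x. \<lbrakk>a \<in> carrier R; x \<in> carrier M\<rbrakk> \<Longrightarrow> h (a \<odot>\<^bsub>M\<^esub> x) = a \<odot>\<^bsub>N\<^esub> h x"
    using assms by (auto simp: module_isomorphic_def)
  let ?k = "inv_into (carrier M) h"
  have bij: "bij_betw h (carrier M) (carrier N)" using h by (simp add: iso_def)
  have "?k \<in> iso (add_monoid N) (add_monoid M)" using M.a_group group.iso_set_sym[OF _ h] by simp
  moreover have "?k (a \<odot>\<^bsub>N\<^esub> y) = a \<odot>\<^bsub>M\<^esub> ?k y" if a: "a \<in> carrier R" and y: "y \<in> carrier N" for a y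
  proof -
    have k: "?k y \<in> carrier M" "h (?k y) = y"
      using bij y by (auto simp: bij_betw_def inv_into_into f_inv_into_f)
    then have "a \<odot>\<^bsub>N\<^esub> y = h (a \<odot>\<^bsub>M\<^esub> ?k y)" using lin a by simp
    then show ?thesis using bij k a by (simp add: bij_betw_def inv_into_f_f)
  qed
  ultimately show ?thesis by (auto simp: module_isomorphic_def)
qed

lemma module_isomorphic_trans:
  assumes "module_isomorphic R M N" "module_isomorphic R N P"
  shows "module_isomorphic R M P"
proof -
  obtain h where h: "h \<in> iso (add_monoid M) (add_monoid N)"
    and hl: "\<And>a x. \<lbrakk>a \<in> carrier R; x \<in> carrier M\<rbrakk> \<Longrightarrow> h (a \<odot>\<^bsub>M\<^esub> x) = a \<odot>\<^bsub>N\<^esub> h x"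
    using assms(1) by (auto simp: module_isomorphic_def)
  obtain k where k: "k \<in> iso (add_monoid N) (add_monoid P)"
    and kl: "\<And>a x. \<lbrakk>a \<in> carrier R; x \<in> carrier N\<rbrakk> \<Longrightarrow> k (a \<odot>\<^bsub>N\<^esub> x) = a \<odot>\<^bsub>P\<^esub> k x"
    using assms(2) by (auto simp: module_isomorphic_def)
  have "k \<circ> h \<in> iso (add_monoid M) (add_monoid P)" using h k by (rule iso_set_trans)
  moreover have "(k \<circ> h) (a \<odot>\<^bsub>M\<^esub> x) = a \<odot>\<^bsub>P\<^esub> (k \<circ> h) x" if "a \<in> carrier R" "x \<in> carrier M" for a x
    using that hl kl h by (auto simp: iso_def hom_def Pi_def)
  ultimately show ?thesis unfolding module_isomorphic_def by blast
qed

text \<open>Over a finite index set, summing over the support is summing over the whole index set.\<close>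

lemma (in left_module) finite_internal_direct_sum_bij:
  assumes ds: "internal_direct_sum R M A N" and A: "finite A"
  shows "bij_betw (\<lambda>f. \<Oplus>\<^bsub>M\<^esub> i \<in> A. f i) (\<Pi>\<^sub>E i \<in> A. N i) (carrier M)"
proof -
  let ?s = "\<lambda>f. \<Oplus>\<^bsub>M\<^esub> i \<in> A. f i"
  have sm: "submodule (N i) R M" if "i \<in> A" for i using ds that by (simp add: internal_direct_sum_def)
  have car: "f i \<in> carrier M" if "f \<in> (\<Pi>\<^sub>E i \<in> A. N i)" "i \<in> A" for f i
    using that submoduleD(3)[OF sm] by blast
  have s: "(\<Oplus>\<^bsub>M\<^esub> i \<in> {i \<in> A. f i \<noteq> \<zero>\<^bsub>M\<^esub>}. f i) = ?s f" if "f \<in> (\<Pi>\<^sub>E i \<in> A. N i)" for f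
    using A by (rule M.add.finprod_mono_neutral_cong_left) (use car[OF that] in auto)
  have ex1: "\<exists>!f. f \<in> (\<Pi>\<^sub>E i \<in> A. N i) \<and> finite {i \<in> A. f i \<noteq> \<zero>\<^bsub>M\<^esub>} \<and>
      x = (\<Oplus>\<^bsub>M\<^esub> i \<in> {i \<in> A. f i \<noteq> \<zero>\<^bsub>M\<^esub>}. f i)" if "x \<in> carrier M" for x
    using ds that by (simp add: internal_direct_sum_def)
  have closed: "?s f \<in> carrier M" if "f \<in> (\<Pi>\<^sub>E i \<in> A. N i)" for f
    using car[OF that] by (intro M.finsum_closed) auto
  show ?thesis
  proof (rule bij_betwI')
    fix f g assume fg: "f \<in> (\<Pi>\<^sub>E i \<in> A. N i)" "g \<in> (\<Pi>\<^sub>E i \<in> A. N i)"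
    show "?s f = ?s g \<longleftrightarrow> f = g"
    proof
      assume eq: "?s f = ?s g"
      show "f = g"
        by (rule Ex1_unique[OF ex1[OF closed[OF fg(1)]]]) (use fg A s[OF fg(1)] s[OF fg(2)] eq in auto)
    qed simp
  next
    fix x assume "x \<in> carrier M"
    from ex1[OF this] show "\<exists>f \<in> (\<Pi>\<^sub>E i \<in> A. N i). x = ?s f" using s by metis
  qed (rule closed)
qed

text \<open>The isomorphism takes the components \<open>c x\<close> of \<open>x\<close>, maps them componentwise and adds up the results. It
  is bijective as a composition of three bijections, and linear because the component map \<open>c\<close>, being the
  inverse of the linear summation map, is linear.\<close>

lemma module_isomorphic_internal_direct_sum:
  assumes P: "left_module R P" and Q: "left_module R Q" and A: "finite A"
    and dsP: "internal_direct_sum R P A N" and dsQ: "internal_direct_sum R Q A L"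
    and iso: "\<And>i. i \<in> A \<Longrightarrow> module_isomorphic R (submodule_structure P (N i)) (submodule_structure Q (L i))"
  shows "module_isomorphic R P Q"
proof -
  interpret P: left_module R P by fact
  interpret Q: left_module R Q by fact
  have smP: "submodule (N i) R P" and smQ: "submodule (L i) R Q" if "i \<in> A" for i
    using dsP dsQ that by (simp_all add: internal_direct_sum_def)
  have "\<forall>i \<in> A. \<exists>h. h \<in> iso (add_monoid (submodule_structure P (N i))) (add_monoid (submodule_structure Q (L i))) \<and>
      (\<forall>a \<in> carrier R. \<forall>x \<in> N i. h (a \<odot>\<^bsub>P\<^esub> x) = a \<odot>\<^bsub>Q\<^esub> h x)"
    using iso by (fastforce simp: module_isomorphic_def)
  then obtain h where h: "\<And>i. i \<in> A \<Longrightarrow> h i \<in> iso (add_monoid (submodule_structure P (N i))) (add_monoid (submodule_structure Q (L i)))"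
    and smult: "\<And>i a x. \<lbrakk>i \<in> A; a \<in> carrier R; x \<in> N i\<rbrakk> \<Longrightarrow> h i (a \<odot>\<^bsub>P\<^esub> x) = a \<odot>\<^bsub>Q\<^esub> h i x"
    by metis
  have bij: "bij_betw (h i) (N i) (L i)" if "i \<in> A" for i using h[OF that] by (simp add: iso_def)
  have add: "h i (x \<oplus>\<^bsub>P\<^esub> y) = h i x \<oplus>\<^bsub>Q\<^esub> h i y" if "i \<in> A" "x \<in> N i" "y \<in> N i" for i x y
    using h[OF that(1)] that by (simp add: iso_def hom_def)
  let ?P = "\<Pi>\<^sub>E i \<in> A. N i" and ?Q = "\<Pi>\<^sub>E i \<in> A. L i"
  let ?s = "\<lambda>f. \<Oplus>\<^bsub>P\<^esub> i \<in> A. f i" and ?t = "\<lambda>f. \<Oplus>\<^bsub>Q\<^esub> i \<in> A. f i"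
  let ?T = "\<lambda>f. \<lambda>i \<in> A. h i (f i)"
  have s: "bij_betw ?s ?P (carrier P)" using dsP A by (rule P.finite_internal_direct_sum_bij)
  have t: "bij_betw ?t ?Q (carrier Q)" using dsQ A by (rule Q.finite_internal_direct_sum_bij)
  have hL: "h i x \<in> L i" if "i \<in> A" "x \<in> N i" for i x using bij[OF that(1)] that(2) by (auto simp: bij_betw_def)
  have T: "bij_betw ?T ?P ?Q"
  proof (rule bij_betw_byWitness[where f' = "\<lambda>g. \<lambda>i \<in> A. inv_into (N i) (h i) (g i)"])
    show "\<forall>f \<in> ?P. (\<lambda>i \<in> A. inv_into (N i) (h i) (?T f i)) = f"
    proof
      fix f assume f: "f \<in> ?P"
      show "(\<lambda>i \<in> A. inv_into (N i) (h i) (?T f i)) = f"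
        using f bij by (intro extensionalityI[of _ A]) (auto simp: bij_betw_def PiE_def intro!: inv_into_f_f)
    qed
    show "\<forall>g \<in> ?Q. ?T (\<lambda>i \<in> A. inv_into (N i) (h i) (g i)) = g"
    proof
      fix g assume g: "g \<in> ?Q"
      show "?T (\<lambda>i \<in> A. inv_into (N i) (h i) (g i)) = g"
        using g bij by (intro extensionalityI[of _ A]) (auto simp: bij_betw_def PiE_def intro!: f_inv_into_f)
    qed
    show "?T ` ?P \<subseteq> ?Q" using hL by (auto simp: PiE_mem)
    show "(\<lambda>g. \<lambda>i \<in> A. inv_into (N i) (h i) (g i)) ` ?Q \<subseteq> ?P"
      using bij by (auto simp: bij_betw_def PiE_mem intro!: inv_into_into)
  qed
  define c where "c = inv_into ?P ?s"
  have c: "bij_betw c (carrier P) ?P" unfolding c_def using s by (rule bij_betw_inv_into)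
  have cP: "c x \<in> ?P" if "x \<in> carrier P" for x using c that by (auto simp: bij_betw_def)
  have sc: "?s (c x) = x" if "x \<in> carrier P" for x
    unfolding c_def using s that by (rule bij_betw_inv_into_right)
  have cs: "c (?s f) = f" if "f \<in> ?P" for f
    unfolding c_def using s that by (rule bij_betw_inv_into_left)
  have carP: "f i \<in> carrier P" if "f \<in> ?P" "i \<in> A" for f i using that P.submoduleD(3)[OF smP] by blast
  have carQ: "h i (f i) \<in> carrier Q" if "f \<in> ?P" "i \<in> A" for f i
    using that hL Q.submoduleD(3)[OF smQ] by blast
  have tT: "?t (?T f) = (\<Oplus>\<^bsub>Q\<^esub> i \<in> A. h i (f i))" if "f \<in> ?P" for f
    using carQ[OF that] by (intro Q.finsum_cong') auto
  let ?H = "\<lambda>x. ?t (?T (c x))"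
  have H: "bij_betw ?H (carrier P) (carrier Q)"
    using bij_betw_trans[OF c bij_betw_trans[OF T t]] by (simp only: comp_def)
  have c_add: "c (x \<oplus>\<^bsub>P\<^esub> y) = (\<lambda>i \<in> A. c x i \<oplus>\<^bsub>P\<^esub> c y i)" if x: "x \<in> carrier P" and y: "y \<in> carrier P" for x y
  proof -
    let ?f = "\<lambda>i \<in> A. c x i \<oplus>\<^bsub>P\<^esub> c y i"
    have f: "?f \<in> ?P" using cP[OF x] cP[OF y] P.submoduleD(5)[OF smP] by (auto simp: PiE_mem)
    have "?s ?f = (\<Oplus>\<^bsub>P\<^esub> i \<in> A. c x i \<oplus>\<^bsub>P\<^esub> c y i)"
      using carP[OF cP[OF x]] carP[OF cP[OF y]] by (intro P.finsum_cong') auto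
    also have "\<dots> = ?s (c x) \<oplus>\<^bsub>P\<^esub> ?s (c y)"
      using carP[OF cP[OF x]] carP[OF cP[OF y]] by (intro P.finsum_addf) auto
    finally show ?thesis using cs[OF f] sc x y by simp
  qed
  have c_smult: "c (a \<odot>\<^bsub>P\<^esub> x) = (\<lambda>i \<in> A. a \<odot>\<^bsub>P\<^esub> c x i)" if a: "a \<in> carrier R" and x: "x \<in> carrier P" for a x
  proof -
    let ?f = "\<lambda>i \<in> A. a \<odot>\<^bsub>P\<^esub> c x i"
    have f: "?f \<in> ?P" using cP[OF x] P.submoduleD(6)[OF smP] a by (auto simp: PiE_mem)
    have "?s ?f = (\<Oplus>\<^bsub>P\<^esub> i \<in> A. a \<odot>\<^bsub>P\<^esub> c x i)"
      using carP[OF cP[OF x]] a by (intro P.finsum_cong') auto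
    also have "\<dots> = a \<odot>\<^bsub>P\<^esub> ?s (c x)"
      using carP[OF cP[OF x]] a A by (intro P.smult_finsum[symmetric]) auto
    finally show ?thesis using cs[OF f] sc x by simp
  qed
  have H_add: "?H (x \<oplus>\<^bsub>P\<^esub> y) = ?H x \<oplus>\<^bsub>Q\<^esub> ?H y" if x: "x \<in> carrier P" and y: "y \<in> carrier P" for x y
  proof -
    note q = carQ[OF cP[OF x]] carQ[OF cP[OF y]]
    have "?H (x \<oplus>\<^bsub>P\<^esub> y) = (\<Oplus>\<^bsub>Q\<^esub> i \<in> A. h i (c (x \<oplus>\<^bsub>P\<^esub> y) i))" using x y by (intro tT cP) simp
    also have "\<dots> = (\<Oplus>\<^bsub>Q\<^esub> i \<in> A. h i (c x i) \<oplus>\<^bsub>Q\<^esub> h i (c y i))"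
      using q cP[OF x] cP[OF y] by (intro Q.finsum_cong') (auto simp: c_add[OF x y] add PiE_mem)
    also have "\<dots> = (\<Oplus>\<^bsub>Q\<^esub> i \<in> A. h i (c x i)) \<oplus>\<^bsub>Q\<^esub> (\<Oplus>\<^bsub>Q\<^esub> i \<in> A. h i (c y i))"
      using q by (intro Q.finsum_addf) auto
    finally show ?thesis using tT[OF cP[OF x]] tT[OF cP[OF y]] by simp
  qed
  have H_smult: "?H (a \<odot>\<^bsub>P\<^esub> x) = a \<odot>\<^bsub>Q\<^esub> ?H x" if a: "a \<in> carrier R" and x: "x \<in> carrier P" for a x
  proof -
    note q = carQ[OF cP[OF x]]
    have "?H (a \<odot>\<^bsub>P\<^esub> x) = (\<Oplus>\<^bsub>Q\<^esub> i \<in> A. h i (c (a \<odot>\<^bsub>P\<^esub> x) i))" using a x by (intro tT cP) simp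
    also have "\<dots> = (\<Oplus>\<^bsub>Q\<^esub> i \<in> A. a \<odot>\<^bsub>Q\<^esub> h i (c x i))"
      using q cP[OF x] a by (intro Q.finsum_cong') (auto simp: c_smult[OF a x] smult PiE_mem)
    also have "\<dots> = a \<odot>\<^bsub>Q\<^esub> (\<Oplus>\<^bsub>Q\<^esub> i \<in> A. h i (c x i))"
      using q a A by (intro Q.smult_finsum[symmetric]) auto
    finally show ?thesis using tT[OF cP[OF x]] by simp
  qed
  have "?H \<in> iso (add_monoid P) (add_monoid Q)"
    using H H_add by (auto simp: iso_def hom_def bij_betw_def)
  then show ?thesis unfolding module_isomorphic_def by (rule bexI[rotated]) (intro ballI H_smult)
qed

lemma decomposition_isomorphic_refl: "decomposition_isomorphic R M D D"
  unfolding decomposition_isomorphic_def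
  by (intro exI[of _ "\<lambda>N. N"]) (simp add: bij_betw_def module_isomorphic_refl)

lemma (in left_module) decomposition_isomorphic_sym:
  assumes D: "decomposition R M D" and iso: "decomposition_isomorphic R M D E"
  shows "decomposition_isomorphic R M E D"
proof -
  obtain \<phi> where \<phi>: "bij_betw \<phi> D E"
    and i: "\<And>N. N \<in> D \<Longrightarrow> module_isomorphic R (submodule_structure M N) (submodule_structure M (\<phi> N))"
    using iso by (auto simp: decomposition_isomorphic_def)
  have "module_isomorphic R (submodule_structure M L) (submodule_structure M (inv_into D \<phi> L))"
    if L: "L \<in> E" for L
  proof -
    have N: "inv_into D \<phi> L \<in> D" "\<phi> (inv_into D \<phi> L) = L"
      using \<phi> L by (auto simp: bij_betw_def inv_into_into f_inv_into_f)
    then have "left_module R (submodule_structure M (inv_into D \<phi> L))"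
      using D left_module_submodule_structure by (simp add: decomposition_iff)
    then show ?thesis using left_module.module_isomorphic_sym i[OF N(1)] unfolding N(2) by blast
  qed
  then show ?thesis using bij_betw_inv_into[OF \<phi>] unfolding decomposition_isomorphic_def by blast
qed

lemma decomposition_isomorphic_trans:
  assumes "decomposition_isomorphic R M D E" "decomposition_isomorphic R M E F"
  shows "decomposition_isomorphic R M D F"
proof -
  obtain \<phi> \<psi> where \<phi>: "bij_betw \<phi> D E" and \<psi>: "bij_betw \<psi> E F"
    and i: "\<And>N. N \<in> D \<Longrightarrow> module_isomorphic R (submodule_structure M N) (submodule_structure M (\<phi> N))"
    and j: "\<And>N. N \<in> E \<Longrightarrow> module_isomorphic R (submodule_structure M N) (submodule_structure M (\<psi> N))"
    using assms by (auto simp: decomposition_isomorphic_def)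
  have "module_isomorphic R (submodule_structure M N) (submodule_structure M ((\<psi> \<circ> \<phi>) N))" if "N \<in> D" for N
    using module_isomorphic_trans[OF i[OF that] j[of "\<phi> N"]] \<phi> that by (auto simp: bij_betw_def)
  then show ?thesis using bij_betw_trans[OF \<phi> \<psi>] unfolding decomposition_isomorphic_def by blast
qed

section \<open>Finiteness up to an equivalence\<close>

text \<open>Each class in \<open>T\<close> is the trace of a class in \<open>S\<close>.\<close>

lemma finitely_many_up_to_subset:
  assumes "finitely_many_up_to r S" "T \<subseteq> S"
  shows "finitely_many_up_to r T"
proof -
  let ?R = "\<lambda>S. {(x, y). x \<in> S \<and> y \<in> S \<and> r x y}"
  have "T // ?R T \<subseteq> (\<lambda>c. c \<inter> T) ` (S // ?R S)"
  proof
    fix c assume "c \<in> T // ?R T"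
    then obtain x where x: "x \<in> T" "c = ?R T `` {x}" by (rule quotientE)
    then have "c = ?R S `` {x} \<inter> T" using assms(2) by auto
    moreover have "?R S `` {x} \<in> S // ?R S" using x(1) assms(2) by (intro quotientI) blast
    ultimately show "c \<in> (\<lambda>c. c \<inter> T) ` (S // ?R S)" by (rule image_eqI)
  qed
  then show ?thesis using assms(1) unfolding finitely_many_up_to_def by (meson finite_imageI finite_subset)
qed

lemma finitely_many_up_to_representatives:
  assumes fin: "finitely_many_up_to r S" and refl: "\<And>x. x \<in> S \<Longrightarrow> r x x"
  obtains T where "finite T" "T \<subseteq> S" "\<forall>x \<in> S. \<exists>t \<in> T. r x t"
proof
  let ?cl = "\<lambda>x. {(x, y). x \<in> S \<and> y \<in> S \<and> r x y} `` {x}"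
  let ?rep = "inv_into S ?cl"
  have q: "S // {(x, y). x \<in> S \<and> y \<in> S \<and> r x y} = ?cl ` S" by (auto simp: quotient_def)
  show "finite (?rep ` ?cl ` S)" using fin unfolding finitely_many_up_to_def q by simp
  show "?rep ` ?cl ` S \<subseteq> S" using inv_into_into[of _ ?cl S] by blast
  show "\<forall>x \<in> S. \<exists>t \<in> ?rep ` ?cl ` S. r x t"
  proof
    fix x assume x: "x \<in> S"
    have t: "?rep (?cl x) \<in> S" "?cl (?rep (?cl x)) = ?cl x"
      using x inv_into_into[of "?cl x" ?cl S] f_inv_into_f[of "?cl x" ?cl S] by blast+
    then have "?rep (?cl x) \<in> ?cl x" using refl by blast
    then show "\<exists>t \<in> ?rep ` ?cl ` S. r x t" using x by blast
  qed
qed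

lemma finitely_many_up_to_if_finite_invariant:
  assumes fin: "finite (f ` S)" and r: "\<And>x y. \<lbrakk>x \<in> S; y \<in> S; f x = f y\<rbrakk> \<Longrightarrow> r x y"
    and sym: "\<And>x y. \<lbrakk>x \<in> S; y \<in> S; r x y\<rbrakk> \<Longrightarrow> r y x"
    and trans: "\<And>x y z. \<lbrakk>x \<in> S; y \<in> S; z \<in> S; r x y; r y z\<rbrakk> \<Longrightarrow> r x z"
  shows "finitely_many_up_to r S"
proof -
  let ?cl = "\<lambda>x. {(x, y). x \<in> S \<and> y \<in> S \<and> r x y} `` {x}"
  have cl: "?cl x = ?cl y" if "x \<in> S" "y \<in> S" "f x = f y" for x y
    using r[OF that] sym[OF that(1,2)] trans that by blast
  have "S // {(x, y). x \<in> S \<and> y \<in> S \<and> r x y} \<subseteq> (\<lambda>v. ?cl (inv_into S f v)) ` f ` S"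
  proof
    fix c assume "c \<in> S // {(x, y). x \<in> S \<and> y \<in> S \<and> r x y}"
    then obtain x where x: "x \<in> S" "c = ?cl x" by (rule quotientE)
    have "c = ?cl (inv_into S f (f x))"
      unfolding x(2) using x(1) by (intro cl) (auto simp: inv_into_into f_inv_into_f)
    then show "c \<in> (\<lambda>v. ?cl (inv_into S f v)) ` f ` S" using x(1) by blast
  qed
  then show ?thesis unfolding finitely_many_up_to_def using fin by (meson finite_imageI finite_subset)
qed

section \<open>Decompositions as partitions of indecomposable decompositions\<close>

text \<open>Suppose that \<open>D\<close> and \<open>D'\<close> are refined by \<open>C\<close> and \<open>C'\<close>, and that \<open>\<phi>\<close> and \<open>\<phi>'\<close> carry these refinements
  isomorphically into one common family of submodules. A member \<open>N\<close> of \<open>D\<close> is the sum of \<open>C N\<close>, so it is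
  determined by the block \<open>\<phi> ` C N\<close>; likewise for \<open>D'\<close>. If the blocks are the same, members with equal
  blocks correspond bijectively, and \<open>C N\<close> and \<open>C' N'\<close> match up isomorphically through the common block,
  so that \<open>N\<close> and \<open>N'\<close> are isomorphic.\<close>

lemma (in left_module) decomposition_isomorphic_if_same_partition:
  assumes D: "decomposition R M D" and C: "\<And>N. N \<in> D \<Longrightarrow> decomposition R (submodule_structure M N) (C N)"
    and D': "decomposition R M D'" and C': "\<And>N. N \<in> D' \<Longrightarrow> decomposition R (submodule_structure M N) (C' N)"
    and fin: "\<And>N. N \<in> D \<Longrightarrow> finite (C N)"
    and inj: "inj_on \<phi> (\<Union>N \<in> D. C N)" and inj': "inj_on \<phi>' (\<Union>N \<in> D'. C' N)"
    and iso: "\<And>N K. \<lbrakk>N \<in> D; K \<in> C N\<rbrakk> \<Longrightarrow> module_isomorphic R (submodule_structure M K) (submodule_structure M (\<phi> K))"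
    and iso': "\<And>N K. \<lbrakk>N \<in> D'; K \<in> C' N\<rbrakk> \<Longrightarrow> module_isomorphic R (submodule_structure M K) (submodule_structure M (\<phi>' K))"
    and eq: "(\<lambda>N. \<phi> ` C N) ` D = (\<lambda>N. \<phi>' ` C' N) ` D'"
  shows "decomposition_isomorphic R M D D'"
proof -
  have block_inj: "inj_on (\<lambda>N. \<phi> ` C N) D"
    if D: "decomposition R M D" and C: "\<And>N. N \<in> D \<Longrightarrow> decomposition R (submodule_structure M N) (C N)"
      and inj: "inj_on \<phi> (\<Union>N \<in> D. C N)"
    for D C and \<phi> :: "'b set \<Rightarrow> 'b set"
  proof (rule inj_onI)
    fix N N' assume N: "N \<in> D" "N' \<in> D" and "\<phi> ` C N = \<phi> ` C N'"
    then have eq: "C N = C N'" using inj_on_image_eq_iff[OF inj, of "C N" "C N'"] by blast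
    have "submodule_sum M (C N) = N" if "N \<in> D" for N
      using C[OF that] D that decomposition_submodule_structure_iff[of N] by (simp add: decomposition_iff)
    then show "N = N'" using eq N by metis
  qed
  let ?g = "\<lambda>N. \<phi> ` C N" and ?g' = "\<lambda>N. \<phi>' ` C' N"
  let ?\<theta> = "\<lambda>N. inv_into D' ?g' (?g N)"
  have g: "bij_betw ?g D (?g ` D)" using block_inj[OF D C inj] by (rule inj_on_imp_bij_betw)
  have g': "bij_betw ?g' D' (?g ` D)" using block_inj[OF D' C' inj'] eq by (simp add: bij_betw_def)
  have "bij_betw ?\<theta> D D'" using bij_betw_trans[OF g bij_betw_inv_into[OF g']] by (simp add: comp_def)
  moreover have "module_isomorphic R (submodule_structure M N) (submodule_structure M (?\<theta> N))" if N: "N \<in> D" for N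
  proof -
    define N' where "N' = ?\<theta> N"
    have mem: "?g N \<in> ?g' ` D'" using N eq by blast
    have N': "N' \<in> D'" "?g' N' = ?g N"
      unfolding N'_def using inv_into_into[OF mem] f_inv_into_f[OF mem] by blast+
    have sN: "submodule N R M" and sN': "submodule N' R M" using D D' N N'(1) by (simp_all add: decomposition_iff)
    interpret N: left_module R "submodule_structure M N" using sN by (rule left_module_submodule_structure)
    interpret N': left_module R "submodule_structure M N'" using sN' by (rule left_module_submodule_structure)
    let ?\<psi> = "\<lambda>K. inv_into (C' N') \<phi>' (\<phi> K)"
    have b: "bij_betw \<phi> (C N) (?g N)"
      using inj N by (auto simp: bij_betw_def intro: inj_on_subset)
    have b': "bij_betw \<phi>' (C' N') (?g N)"
      using inj' N' by (auto simp: bij_betw_def intro: inj_on_subset)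
    have \<psi>: "bij_betw ?\<psi> (C N) (C' N')"
      using bij_betw_trans[OF b bij_betw_inv_into[OF b']] by (simp add: comp_def)
    show ?thesis unfolding N'_def[symmetric]
    proof (rule module_isomorphic_internal_direct_sum[OF N.left_module_axioms N'.left_module_axioms fin[OF N]])
      show "internal_direct_sum R (submodule_structure M N) (C N) (\<lambda>K. K)"
        using C[OF N] by (simp add: decomposition_def)
      show "internal_direct_sum R (submodule_structure M N') (C N) ?\<psi>"
        using N'.indexed_decomposition_iff[of "C N" ?\<psi>] \<psi> C'[OF N'(1)] by (simp add: bij_betw_def)
      fix K assume K: "K \<in> C N"
      have \<psi>K: "?\<psi> K \<in> C' N'" "\<phi>' (?\<psi> K) = \<phi> K"
        using \<psi> b' K N'(2) by (auto simp: bij_betw_def intro!: f_inv_into_f)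
      have "submodule (?\<psi> K) R M"
        using C'[OF N'(1)] \<psi>K(1) by (simp add: decomposition_submodule_structure_iff[OF sN'])
      then have "module_isomorphic R (submodule_structure M (\<phi>' (?\<psi> K))) (submodule_structure M (?\<psi> K))"
        using iso'[OF N'(1) \<psi>K(1)] left_module.module_isomorphic_sym left_module_submodule_structure by blast
      then have "module_isomorphic R (submodule_structure M K) (submodule_structure M (?\<psi> K))"
        using iso[OF N K] unfolding \<psi>K(2) by (metis module_isomorphic_trans)
      then show "module_isomorphic R (submodule_structure (submodule_structure M N) K)
          (submodule_structure (submodule_structure M N') (?\<psi> K))" by simp
    qed
  qed
  ultimately show ?thesis unfolding decomposition_isomorphic_def by blast
qed

lemma AKS1_imp_AKS2: "AKS1 R M \<Longrightarrow> AKS2 R M"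
  unfolding AKS1_def AKS2_def
  by (rule finitely_many_up_to_subset) (auto simp: indecomposable_decomposition_def)

text \<open>Fix finitely many indecomposable decompositions \<open>T\<close> representing all of them. Refining \<open>D\<close> into a
  finite indecomposable decomposition and moving that to its representative \<open>t\<close> turns \<open>D\<close> into a
  partition of the finite set \<open>t\<close>. The partition determines \<open>D\<close> up to isomorphism, and there are only
  finitely many partitions of the finite members of \<open>T\<close>.\<close>

lemma (in left_module) AKS2_imp_AKS1:
  assumes ref: "all_refine_finite_indecomposable R M" and aks2: "AKS2 R M"
  shows "AKS1 R M"
proof -
  let ?S = "{D. decomposition R M D}"
  obtain T where T: "finite T" "\<forall>E. indecomposable_decomposition R M E \<longrightarrow> (\<exists>t \<in> T. decomposition_isomorphic R M E t)"
    by (rule finitely_many_up_to_representatives[OF aks2[unfolded AKS2_def] decomposition_isomorphic_refl]) auto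
  have "\<forall>D \<in> ?S. \<exists>C \<phi> t. t \<in> T \<and> (\<forall>N \<in> D. decomposition R (submodule_structure M N) (C N)) \<and>
      finite (\<Union>N \<in> D. C N) \<and> bij_betw \<phi> (\<Union>N \<in> D. C N) t \<and>
      (\<forall>K \<in> (\<Union>N \<in> D. C N). module_isomorphic R (submodule_structure M K) (submodule_structure M (\<phi> K)))"
  proof
    fix D assume "D \<in> ?S"
    then obtain E where E: "finite E" "indecomposable_decomposition R M E" "refines_into R M D E"
      using ref by (auto simp: all_refine_finite_indecomposable_def)
    then obtain C where C: "\<forall>N \<in> D. decomposition R (submodule_structure M N) (C N)" "(\<Union>N \<in> D. C N) = E"
      by (auto simp: refines_into_def)
    obtain t \<phi> where "t \<in> T" "bij_betw \<phi> E t"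
      "\<forall>K \<in> E. module_isomorphic R (submodule_structure M K) (submodule_structure M (\<phi> K))"
      using T(2) E(2) unfolding decomposition_isomorphic_def by blast
    then show "\<exists>C \<phi> t. t \<in> T \<and> (\<forall>N \<in> D. decomposition R (submodule_structure M N) (C N)) \<and>
      finite (\<Union>N \<in> D. C N) \<and> bij_betw \<phi> (\<Union>N \<in> D. C N) t \<and>
      (\<forall>K \<in> (\<Union>N \<in> D. C N). module_isomorphic R (submodule_structure M K) (submodule_structure M (\<phi> K)))"
      using C E(1) by (intro exI[of _ C] exI[of _ \<phi>] exI[of _ t]) simp
  qed
  then obtain C \<phi> t where W: "\<And>D. D \<in> ?S \<Longrightarrow> t D \<in> T \<and> (\<forall>N \<in> D. decomposition R (submodule_structure M N) (C D N)) \<and>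
      finite (\<Union>N \<in> D. C D N) \<and> bij_betw (\<phi> D) (\<Union>N \<in> D. C D N) (t D) \<and>
      (\<forall>K \<in> (\<Union>N \<in> D. C D N). module_isomorphic R (submodule_structure M K) (submodule_structure M (\<phi> D K)))"
    by metis
  let ?f = "\<lambda>D. (\<lambda>N. \<phi> D ` C D N) ` D"
  have "?f ` ?S \<subseteq> (\<Union>t \<in> {t \<in> T. finite t}. Pow (Pow t))"
  proof
    fix p assume "p \<in> ?f ` ?S"
    then obtain D where D: "D \<in> ?S" "p = ?f D" by blast
    note w = W[OF D(1)]
    have "finite (t D)" using w bij_betw_finite by blast
    moreover have "p \<in> Pow (Pow (t D))" using w D(2) by (auto simp: bij_betw_def)
    ultimately show "p \<in> (\<Union>t \<in> {t \<in> T. finite t}. Pow (Pow t))" using w by blast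
  qed
  moreover have "finite (\<Union>t \<in> {t \<in> T. finite t}. Pow (Pow t))" using T(1) by auto
  ultimately have "finite (?f ` ?S)" by (rule finite_subset)
  then show ?thesis unfolding AKS1_def
  proof (rule finitely_many_up_to_if_finite_invariant)
    fix D D' assume D: "D \<in> ?S" and D': "D' \<in> ?S" and eq: "?f D = ?f D'"
    note w = W[OF D] and w' = W[OF D']
    show "decomposition_isomorphic R M D D'"
    proof (rule decomposition_isomorphic_if_same_partition[OF _ _ _ _ _ _ _ _ _ eq])
      show "finite (C D N)" if "N \<in> D" for N using w that by (meson UN_upper finite_subset)
    qed (use w w' D D' in \<open>auto simp: bij_betw_def\<close>)
  next
    show "decomposition_isomorphic R M E D"
      if "D \<in> ?S" "E \<in> ?S" "decomposition_isomorphic R M D E" for D E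
      using that decomposition_isomorphic_sym by blast
  next
    show "decomposition_isomorphic R M D F"
      if "decomposition_isomorphic R M D E" "decomposition_isomorphic R M E F" for D E F
      using that by (rule decomposition_isomorphic_trans)
  qed
qed

section \<open>Direct summands\<close>

lemma (in left_module) subset_set_add:
  assumes K: "submodule K R M" and L: "submodule L R M"
  shows "K \<subseteq> K <+>\<^bsub>M\<^esub> L" "L \<subseteq> K <+>\<^bsub>M\<^esub> L"
proof -
  show "K \<subseteq> K <+>\<^bsub>M\<^esub> L"
  proof
    fix x assume x: "x \<in> K"
    then have "x = x \<oplus>\<^bsub>M\<^esub> \<zero>\<^bsub>M\<^esub>" using submoduleD(3)[OF K] by simp
    then show "x \<in> K <+>\<^bsub>M\<^esub> L" using x submoduleD(2)[OF L] unfolding mem_set_add_iff by blast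
  qed
  show "L \<subseteq> K <+>\<^bsub>M\<^esub> L"
  proof
    fix x assume x: "x \<in> L"
    then have "x = \<zero>\<^bsub>M\<^esub> \<oplus>\<^bsub>M\<^esub> x" using submoduleD(3)[OF L] by simp
    then show "x \<in> K <+>\<^bsub>M\<^esub> L" using x submoduleD(2)[OF K] unfolding mem_set_add_iff by blast
  qed
qed

lemma (in left_module) complementary_submodulesI:
  assumes K: "submodule K R M" and L: "submodule L R M"
    and int: "\<And>x. \<lbrakk>x \<in> K; x \<in> L\<rbrakk> \<Longrightarrow> x = \<zero>\<^bsub>M\<^esub>" and sum: "carrier M \<subseteq> K <+>\<^bsub>M\<^esub> L"
  shows "complementary_submodules R M K L"
  unfolding complementary_submodules_def
  using assms submoduleD(2)[OF K] submoduleD(2)[OF L] submoduleD(1)[OF submodule_set_add[OF K L]] by blast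

text \<open>If \<open>N'\<close> complements \<open>N\<close> in \<open>M\<close>, and \<open>L\<close> complements \<open>K\<close> in \<open>N\<close>, then \<open>L + N'\<close> complements \<open>K\<close> in \<open>M\<close>.\<close>

lemma (in left_module) direct_summand_trans:
  assumes N: "direct_summand R M N" and K: "direct_summand R (submodule_structure M N) K"
  shows "direct_summand R M K"
proof -
  obtain N' where N': "complementary_submodules R M N N'" using N by (auto simp: direct_summand_def)
  obtain L where L: "complementary_submodules R (submodule_structure M N) K L"
    using K by (auto simp: direct_summand_def)
  have sN: "submodule N R M" and sN': "submodule N' R M" and NN': "N \<inter> N' = {\<zero>\<^bsub>M\<^esub>}" "N <+>\<^bsub>M\<^esub> N' = carrier M"
    using N' by (simp_all add: complementary_submodules_def)
  have sK: "submodule K R M" "K \<subseteq> N" and sL: "submodule L R M" "L \<subseteq> N"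
    and KL: "K \<inter> L = {\<zero>\<^bsub>M\<^esub>}" "K <+>\<^bsub>M\<^esub> L = N"
    using L by (simp_all add: complementary_submodules_def submodule_submodule_structure_iff[OF sN]
      set_add_submodule_structure)
  note DN = submoduleD[OF sN] and DN' = submoduleD[OF sN'] and DK = submoduleD[OF sK(1)] and DL = submoduleD[OF sL(1)]
  have "complementary_submodules R M K (L <+>\<^bsub>M\<^esub> N')"
  proof (rule complementary_submodulesI[OF sK(1) submodule_set_add[OF sL(1) sN']])
    fix x assume x: "x \<in> K" "x \<in> L <+>\<^bsub>M\<^esub> N'"
    then obtain l n where ln: "l \<in> L" "n \<in> N'" "x = l \<oplus>\<^bsub>M\<^esub> n" by (auto simp: mem_set_add_iff)
    note c = DL(3)[OF ln(1)] DN'(3)[OF ln(2)]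
    have "n = \<ominus>\<^bsub>M\<^esub> l \<oplus>\<^bsub>M\<^esub> x" using c unfolding ln(3) by (simp add: M.a_assoc[symmetric] M.l_neg)
    moreover have "\<ominus>\<^bsub>M\<^esub> l \<oplus>\<^bsub>M\<^esub> x \<in> N" using x(1) ln(1) sK(2) sL(2) by (intro DN(5) DN(4)) auto
    ultimately have "n = \<zero>\<^bsub>M\<^esub>" using ln(2) NN'(1) by blast
    then have "x = l" using ln(3) c by simp
    then show "x = \<zero>\<^bsub>M\<^esub>" using x(1) ln(1) KL(1) by blast
  next
    show "carrier M \<subseteq> K <+>\<^bsub>M\<^esub> (L <+>\<^bsub>M\<^esub> N')"
    proof
      fix x assume "x \<in> carrier M"
      then obtain n n' where n: "n \<in> N" "n' \<in> N'" "x = n \<oplus>\<^bsub>M\<^esub> n'" unfolding NN'(2)[symmetric] mem_set_add_iff by blast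
      then obtain k l where kl: "k \<in> K" "l \<in> L" "n = k \<oplus>\<^bsub>M\<^esub> l" unfolding KL(2)[symmetric] mem_set_add_iff by blast
      have "x = k \<oplus>\<^bsub>M\<^esub> (l \<oplus>\<^bsub>M\<^esub> n')"
        using DK(3)[OF kl(1)] DL(3)[OF kl(2)] DN'(3)[OF n(2)] unfolding n(3) kl(3) by (simp add: M.a_assoc)
      moreover have "l \<oplus>\<^bsub>M\<^esub> n' \<in> L <+>\<^bsub>M\<^esub> N'" using kl(2) n(2) unfolding mem_set_add_iff by blast
      ultimately show "x \<in> K <+>\<^bsub>M\<^esub> (L <+>\<^bsub>M\<^esub> N')"
        using kl(1) mem_set_add_iff[of x M K "L <+>\<^bsub>M\<^esub> N'"] by blast
    qed
  qed
  then show ?thesis by (auto simp: direct_summand_def)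
qed

lemma (in left_module) complementary_submodules_commute:
  assumes "complementary_submodules R M K L"
  shows "complementary_submodules R M L K"
proof -
  have s: "submodule K R M" "submodule L R M" and i: "K \<inter> L = {\<zero>\<^bsub>M\<^esub>}" and e: "K <+>\<^bsub>M\<^esub> L = carrier M"
    using assms by (simp_all add: complementary_submodules_def)
  have "carrier M \<subseteq> L <+>\<^bsub>M\<^esub> K"
  proof
    fix x assume "x \<in> carrier M"
    then obtain k l where "k \<in> K" "l \<in> L" "x = k \<oplus>\<^bsub>M\<^esub> l" unfolding e[symmetric] mem_set_add_iff by blast
    moreover from this have "k \<oplus>\<^bsub>M\<^esub> l = l \<oplus>\<^bsub>M\<^esub> k" using s submoduleD(3) by (intro M.a_comm) blast+
    ultimately show "x \<in> L <+>\<^bsub>M\<^esub> K" unfolding mem_set_add_iff by metis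
  qed
  then show ?thesis using s i by (intro complementary_submodulesI) auto
qed

lemma (in left_module) decomposition_of_complementary_submodules:
  assumes c: "complementary_submodules R M K L" and nz: "K \<noteq> {\<zero>\<^bsub>M\<^esub>}" "L \<noteq> {\<zero>\<^bsub>M\<^esub>}"
  shows "decomposition R M {K, L}"
proof -
  have sK: "submodule K R M" and sL: "submodule L R M" and i: "K \<inter> L = {\<zero>\<^bsub>M\<^esub>}" and e: "K <+>\<^bsub>M\<^esub> L = carrier M"
    using c by (simp_all add: complementary_submodules_def)
  note DK = submoduleD[OF sK] and DL = submoduleD[OF sL]
  have KL: "K \<noteq> L" using i nz by blast
  have s: "submodule (submodule_sum M {K, L}) R M" using sK sL by (intro submodule_submodule_sum) auto
  have "carrier M \<subseteq> submodule_sum M {K, L}"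
  proof
    fix x assume "x \<in> carrier M"
    then obtain k l where "k \<in> K" "l \<in> L" "x = k \<oplus>\<^bsub>M\<^esub> l" unfolding e[symmetric] mem_set_add_iff by blast
    then show "x \<in> submodule_sum M {K, L}"
      using submoduleD(5)[OF s] summand_subset_submodule_sum[OF sK, of "{K, L}"]
        summand_subset_submodule_sum[OF sL, of "{K, L}"] by blast
  qed
  then have sum: "submodule_sum M {K, L} = carrier M" using submoduleD(1)[OF s] by blast
  have "independent_submodules M {K, L}" unfolding independent_submodules_def
  proof (intro allI impI ballI)
    fix F g X assume F: "finite F" "F \<subseteq> {K, L}" and g: "\<forall>K \<in> F. g K \<in> K"
      and rel: "(\<Oplus>\<^bsub>M\<^esub> K \<in> F. g K) = \<zero>\<^bsub>M\<^esub>" and X: "X \<in> F"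
    let ?g = "\<lambda>X. if X \<in> F then g X else \<zero>\<^bsub>M\<^esub>"
    have m: "?g K \<in> K" "?g L \<in> L" using g DK(2) DL(2) by auto
    note c = DK(3)[OF m(1)] DL(3)[OF m(2)]
    have "(\<Oplus>\<^bsub>M\<^esub> X \<in> {K, L}. ?g X) = (\<Oplus>\<^bsub>M\<^esub> X \<in> F. g X)"
    proof (rule finsum_extend_zero)
      show "g X \<in> carrier M" if "X \<in> F" for X using that F(2) g DK(3) DL(3) by blast
    qed (use F in auto)
    moreover have "(\<Oplus>\<^bsub>M\<^esub> X \<in> {K, L}. ?g X) = ?g K \<oplus>\<^bsub>M\<^esub> ?g L"
      using KL c by (simp del: if_split)
    ultimately have z: "?g K \<oplus>\<^bsub>M\<^esub> ?g L = \<zero>\<^bsub>M\<^esub>" using rel by simp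
    have "\<ominus>\<^bsub>M\<^esub> ?g L = ?g K" using z c by (intro M.minus_equality)
    then have gK: "?g K = \<zero>\<^bsub>M\<^esub>" using i DL(4)[OF m(2)] m(1) by (metis IntI singletonD)
    have gL: "?g L = \<zero>\<^bsub>M\<^esub>" using z c(2) unfolding gK by simp
    have "X = K \<or> X = L" using X F(2) by blast
    then have "?g X = \<zero>\<^bsub>M\<^esub>" using gK gL by metis
    then show "g X = \<zero>\<^bsub>M\<^esub>" using X by simp
  qed
  then show ?thesis unfolding decomposition_iff using sK sL nz sum by blast
qed

lemma (in left_module) complementary_partial_sums:
  assumes D: "decomposition R M D" and B: "B \<subseteq> D"
  shows "complementary_submodules R M (submodule_sum M B) (submodule_sum M (D - B))"
proof -
  have sm: "submodule K R M" if "K \<in> D" for K using D that by (simp add: decomposition_iff)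
  have ind: "independent_submodules M (B \<union> (D - B))" and sum: "submodule_sum M D = carrier M"
    using D B by (simp_all add: decomposition_iff Un_absorb1)
  have s: "submodule (submodule_sum M B) R M" "submodule (submodule_sum M (D - B)) R M"
    using sm B by (auto intro!: submodule_submodule_sum)
  have "submodule_sum M B \<inter> submodule_sum M (D - B) = {\<zero>\<^bsub>M\<^esub>}"
    using ind by (rule independent_submodules_disjoint_sums) (use sm B in auto)
  moreover have "submodule_sum M D \<subseteq> submodule_sum M B <+>\<^bsub>M\<^esub> submodule_sum M (D - B)"
  proof (rule submodule_sum_least[OF submodule_set_add[OF s]])
    fix K assume K: "K \<in> D"
    show "K \<subseteq> submodule_sum M B <+>\<^bsub>M\<^esub> submodule_sum M (D - B)"
    proof (cases "K \<in> B")
      case True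
      then show ?thesis
        using summand_subset_submodule_sum[OF sm[OF K] True] subset_set_add(1)[OF s] by blast
    next
      case False
      then show ?thesis
        using summand_subset_submodule_sum[OF sm[OF K], of "D - B"] K subset_set_add(2)[OF s] by blast
    qed
  qed
  ultimately show ?thesis using s sum by (intro complementary_submodulesI) auto
qed

section \<open>Krull-Schmidt artinian modules\<close>

lemma Krull_Schmidt_artinian_chain:
  fixes N :: "nat \<Rightarrow> 'b set"
  assumes ksa: "Krull_Schmidt_artinian R M"
    and ds: "\<And>k. direct_summand R M (N k)" and desc: "\<And>k. N (Suc k) \<subseteq> N k"
  obtains k where "N (Suc k) = N k"
proof -
  have "(\<forall>k. direct_summand R M (N k) \<and> N (Suc k) \<subseteq> N k) \<longrightarrow> (\<exists>k. \<forall>l \<ge> k. N l = N k)"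
    using ksa unfolding Krull_Schmidt_artinian_def by (rule spec)
  moreover have "\<forall>k. direct_summand R M (N k) \<and> N (Suc k) \<subseteq> N k" using ds desc by blast
  ultimately have "\<exists>k. \<forall>l \<ge> k. N l = N k" by (rule mp)
  then obtain k where "\<forall>l \<ge> k. N l = N k" by (rule exE)
  then have "N (Suc k) = N k" using le_SucI[OF le_refl] by blast
  then show ?thesis by (rule that)
qed

text \<open>Removing distinct members \<open>e 0\<close>, \<open>e 1\<close>, and so on of an infinite decomposition one after the other gives
  a descending chain of direct summands. It never stops: \<open>e k\<close> meets the sum of the members other than
  \<open>e 0, ..., e k\<close> only in zero.\<close>

lemma (in left_module) Krull_Schmidt_artinian_finite_decomposition:
  assumes ksa: "Krull_Schmidt_artinian R M" and D: "decomposition R M D"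
  shows "finite D"
proof (rule ccontr)
  assume "infinite D"
  then obtain e :: "nat \<Rightarrow> 'b set" where e: "inj e" "range e \<subseteq> D" using infinite_countable_subset by blast
  let ?B = "\<lambda>k. D - e ` {..<k}"
  let ?N = "\<lambda>k. submodule_sum M (?B k)"
  have sm: "submodule K R M" "K \<noteq> {\<zero>\<^bsub>M\<^esub>}" if "K \<in> D" for K using D that by (simp_all add: decomposition_iff)
  have ds: "direct_summand R M (?N k)" for k
    using complementary_partial_sums[OF D, of "?B k"] by (auto simp: direct_summand_def)
  have desc: "?N (Suc k) \<subseteq> ?N k" for k by (intro submodule_sum_mono) auto
  obtain k where k: "?N (Suc k) = ?N k" using Krull_Schmidt_artinian_chain[of R M ?N, OF ksa ds desc] .
  have eD: "e k \<in> D" using e(2) by blast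
  have "e k \<in> ?B k" using eD e(1) by (auto simp: inj_eq)
  then have "e k \<subseteq> ?N (Suc k)" unfolding k by (rule summand_subset_submodule_sum[OF sm(1)[OF eD]])
  moreover have "submodule_sum M {e k} \<inter> ?N (Suc k) = {\<zero>\<^bsub>M\<^esub>}"
  proof (rule independent_submodules_disjoint_sums)
    show "independent_submodules M ({e k} \<union> ?B (Suc k))"
      by (rule independent_submodules_mono[of M D]) (use D eD in \<open>auto simp: decomposition_iff\<close>)
  qed (use sm eD in auto)
  ultimately have "e k \<subseteq> {\<zero>\<^bsub>M\<^esub>}" using sm eD by (simp add: submodule_sum_singleton) blast
  then show False using sm[OF eD] submoduleD(2) by blast
qed

lemma Krull_Schmidt_artinian_wf:
  assumes "Krull_Schmidt_artinian R M"
  shows "wf {(K, N). direct_summand R M K \<and> direct_summand R M N \<and> K \<subset> N}"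
  unfolding wf_iff_no_infinite_down_chain
proof
  assume "\<exists>f. \<forall>i. (f (Suc i), f i) \<in> {(K, N). direct_summand R M K \<and> direct_summand R M N \<and> K \<subset> N}"
  then obtain f where "\<forall>i. direct_summand R M (f (Suc i)) \<and> direct_summand R M (f i) \<and> f (Suc i) \<subset> f i"
    by auto
  then have ds: "direct_summand R M (f i)" and strict: "f (Suc i) \<subset> f i" for i by blast+
  obtain k where "f (Suc k) = f k"
    using Krull_Schmidt_artinian_chain[of R M f, OF assms ds] strict by blast
  then show False using strict[of k] by blast
qed

text \<open>Well-founded induction on direct summands: a nonzero decomposable \<open>N\<close> splits into two nonzero
  complementary submodules, both proper in \<open>N\<close> and both direct summands of \<open>M\<close>, whose decompositions
  unite to one of \<open>N\<close>. The zero module has the empty decomposition.\<close>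

lemma (in left_module) Krull_Schmidt_artinian_summand_decomposes:
  assumes ksa: "Krull_Schmidt_artinian R M" and N: "direct_summand R M N"
  shows "\<exists>C. finite C \<and> indecomposable_decomposition R (submodule_structure M N) C"
  using Krull_Schmidt_artinian_wf[OF ksa] N
proof (induct N rule: wf_induct_rule)
  case (less N)
  have sN: "submodule N R M" using less(2) by (auto simp: direct_summand_def complementary_submodules_def)
  interpret N: left_module R "submodule_structure M N" using sN by (rule left_module_submodule_structure)
  consider "N = {\<zero>\<^bsub>M\<^esub>}" | "indecomposable_module R (submodule_structure M N)"
    | K L where "complementary_submodules R (submodule_structure M N) K L" "K \<noteq> {\<zero>\<^bsub>M\<^esub>}" "L \<noteq> {\<zero>\<^bsub>M\<^esub>}"
    unfolding indecomposable_module_def by auto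
  then show ?case
  proof cases
    case 1
    have "submodule_sum M {} = N" unfolding 1 by (simp add: submodule_sum_def)
    moreover have "independent_submodules M {}" by (simp add: independent_submodules_def)
    ultimately have "decomposition R (submodule_structure M N) {}"
      by (simp add: decomposition_submodule_structure_iff[OF sN])
    then show ?thesis by (intro exI[of _ "{}"]) (simp add: indecomposable_decomposition_def)
  next
    case 2
    have "independent_submodules M {N}" unfolding independent_submodules_def
    proof (intro allI impI ballI)
      fix F g K assume F: "F \<subseteq> {N}" "\<forall>K \<in> F. g K \<in> K" "(\<Oplus>\<^bsub>M\<^esub> K \<in> F. g K) = \<zero>\<^bsub>M\<^esub>" "K \<in> F"
      then have "F = {N}" "K = N" "g N \<in> carrier M" using submoduleD(3)[OF sN] by auto
      then show "g K = \<zero>\<^bsub>M\<^esub>" using F(3) by simp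
    qed
    moreover have "N \<noteq> {\<zero>\<^bsub>M\<^esub>}" using 2 by (simp add: indecomposable_module_def)
    ultimately have "decomposition R (submodule_structure M N) {N}"
      using sN by (simp add: decomposition_submodule_structure_iff submodule_sum_singleton)
    then show ?thesis using 2 by (intro exI[of _ "{N}"]) (simp add: indecomposable_decomposition_def)
  next
    case (3 K L)
    note c = 3(1) and c' = N.complementary_submodules_commute[OF 3(1)]
    have KL: "submodule K R M" "submodule L R M" "K \<subseteq> N" "L \<subseteq> N" "K \<inter> L = {\<zero>\<^bsub>M\<^esub>}"
      using c by (simp_all add: complementary_submodules_def submodule_submodule_structure_iff[OF sN])
    have "K \<noteq> N" "L \<noteq> N" using KL 3(2,3) by blast+
    moreover have ds: "direct_summand R M K" "direct_summand R M L"
      using c c' direct_summand_trans[OF less(2)] unfolding direct_summand_def by blast+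
    ultimately have "\<forall>X \<in> {K, L}. \<exists>C. finite C \<and> indecomposable_decomposition R (submodule_structure M X) C"
      using less(1)[of K] less(1)[of L] less(2) KL(3,4) by auto
    then obtain C where C: "\<And>X. X \<in> {K, L} \<Longrightarrow> finite (C X) \<and> indecomposable_decomposition R (submodule_structure M X) (C X)"
      by metis
    have "decomposition R (submodule_structure M N) (\<Union>X \<in> {K, L}. C X)"
      using N.decomposition_of_complementary_submodules[OF c] 3(2,3) C
      by (intro N.decomposition_union) (auto simp: indecomposable_decomposition_def)
    then show ?thesis using C
      by (intro exI[of _ "\<Union>X \<in> {K, L}. C X"]) (auto simp: indecomposable_decomposition_def)
  qed
qed

lemma (in left_module) Krull_Schmidt_artinian_imp_all_refine:
  assumes ksa: "Krull_Schmidt_artinian R M"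
  shows "all_refine_finite_indecomposable R M"
  unfolding all_refine_finite_indecomposable_def
proof (intro allI impI)
  fix D assume D: "decomposition R M D"
  have "direct_summand R M N" if "N \<in> D" for N
    using complementary_partial_sums[OF D, of "{N}"] that D submodule_sum_singleton[of N]
    by (auto simp: direct_summand_def decomposition_iff)
  then have "\<forall>N \<in> D. \<exists>C. finite C \<and> indecomposable_decomposition R (submodule_structure M N) C"
    using Krull_Schmidt_artinian_summand_decomposes[OF ksa] by blast
  then obtain C where C: "\<And>N. N \<in> D \<Longrightarrow> finite (C N) \<and> indecomposable_decomposition R (submodule_structure M N) (C N)"
    by metis
  let ?E = "\<Union>N \<in> D. C N"
  have "decomposition R M ?E"
    using C by (intro decomposition_union[OF D]) (simp add: indecomposable_decomposition_def)
  then have "indecomposable_decomposition R M ?E"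
    using C by (auto simp: indecomposable_decomposition_def)
  moreover have "refines_into R M D ?E"
    using C unfolding refines_into_def indecomposable_decomposition_def by blast
  moreover have "finite ?E"
    using Krull_Schmidt_artinian_finite_decomposition[OF ksa D] C by blast
  ultimately show "\<exists>E. finite E \<and> indecomposable_decomposition R M E \<and> refines_into R M D E" by blast
qed

theorem proposition6p1:
  fixes R :: "('a, 'm) ring_scheme" and M :: "('a, 'b, 'n) module_scheme"
  assumes "left_module R M"
  shows "(all_refine_finite_indecomposable R M \<longrightarrow> (AKS1 R M \<longleftrightarrow> AKS2 R M)) \<and>
         (Krull_Schmidt_artinian R M \<longrightarrow> all_refine_finite_indecomposable R M)"
proof -
  interpret left_module R M by fact
  show ?thesis using AKS1_imp_AKS2 AKS2_imp_AKS1 Krull_Schmidt_artinian_imp_all_refine by blast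
qed

end
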